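(* A topological dynamical system $(X,T)$ embeds equivariantly into $(([0,1]^n)^{\mathbb Z},\sigma)$ for some integer $n\geq 1$ if and only if its dynamical dimension $\dim(X,T)$ is finite.
   Context: A topological dynamical system $(X,T)$ consists of a nonempty compact metrizable space $X$ and a homeomorphism $T\colon X\to X$. The shift on $([0,1]^n)^{\mathbb Z}$ (product topology) is $(\sigma z)_k=z_{k+1}$. An equivariant embedding of $(X,T)$ into $(([0,1]^n)^{\mathbb Z},\sigma)$ is a topological embedding $F$ with $F\circ T=\sigma\circ F$. Dynamical dimension (Meyerovitch): let $\mathrm{Cov}(X)$ be the set of finite open covers of $X$, and $\mathrm{Prob}(X,T)$ the set of $T$-invariant Borel probability measures on $X$. For $\mathcal V\in\mathrm{Cov}(X)$ put $\mathrm{ord}(\mathcal V,x)=\#\{V\in\mathcal V:x\in V\}-1$ and $\mathrm{ord}(\mathcal V,T)=\sup_{\mu\in\mathrm{Prob}(X,T)}\int_X\mathrm{ord}(\mathcal V,x)\,d\mu(x)$. Write $\mathcal V\succeq\mathcal U$ if every $V\in\mathcal V$ is contained in some $U\in\mathcal U$. Then $$\dim(\mathcal U,T)=\inf_{\mathcal V\in\mathrm{Cov}(X),\ \mathcal V\succeq\mathcal U}\mathrm{ord}(\mathcal V,T),\qquad \dim(X,T)=\sup_{\mathcal U\in\mathrm{Cov}(X)}\dim(\mathcal U,T)\in[0,\infty].$$ *)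

theory Defs
  imports "HOL-Probability.Probability"
begin

definition top_dyn_system :: "'a topology \<Rightarrow> ('a \<Rightarrow> 'a) \<Rightarrow> bool" where
  "top_dyn_system X T \<longleftrightarrow>
     topspace X \<noteq> {} \<and> compact_space X \<and> metrizable_space X \<and> homeomorphic_map X X T"

(* A point of the unit n-cube is a function on {..<n} with values in [0,1], set to
   undefined outside {..<n} as in every product_topology; this keeps n a term. *)
definition cube :: "nat \<Rightarrow> (nat \<Rightarrow> real) topology" where
  "cube n = product_topology (\<lambda>_. top_of_set {0..1}) {..<n}"

definition cube_shift_space :: "nat \<Rightarrow> (int \<Rightarrow> nat \<Rightarrow> real) topology" where
  "cube_shift_space n = product_topology (\<lambda>_. cube n) UNIV"

definition shift_map :: "(int \<Rightarrow> 'b) \<Rightarrow> int \<Rightarrow> 'b" where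
  "shift_map z = (\<lambda>k. z (k + 1))"

definition equivariant_embedding ::
  "'a topology \<Rightarrow> ('a \<Rightarrow> 'a) \<Rightarrow> 'b topology \<Rightarrow> ('b \<Rightarrow> 'b) \<Rightarrow> ('a \<Rightarrow> 'b) \<Rightarrow> bool" where
  "equivariant_embedding X T Y S F \<longleftrightarrow>
     embedding_map X Y F \<and> (\<forall>x\<in>topspace X. F (T x) = S (F x))"

definition borel_of :: "'a topology \<Rightarrow> 'a measure" where
  "borel_of X = sigma (topspace X) {U. openin X U}"

definition inv_prob :: "'a topology \<Rightarrow> ('a \<Rightarrow> 'a) \<Rightarrow> 'a measure set" where
  "inv_prob X T =
     {\<mu>. sets \<mu> = sets (borel_of X) \<and> prob_space \<mu> \<and>
         (\<forall>A\<in>sets \<mu>. emeasure \<mu> (T -` A \<inter> space \<mu>) = emeasure \<mu> A)}"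

definition Cov :: "'a topology \<Rightarrow> 'a set set set" where
  "Cov X = {\<V>. finite \<V> \<and> (\<forall>V\<in>\<V>. openin X V) \<and> \<Union>\<V> = topspace X}"

definition refines :: "'a set set \<Rightarrow> 'a set set \<Rightarrow> bool" where
  "refines \<V> \<U> \<longleftrightarrow> (\<forall>V\<in>\<V>. \<exists>U\<in>\<U>. V \<subseteq> U)"

(* The natural-number subtraction does not truncate when \<V> is a finite cover
   and x is a point of the covered space. *)
definition ord_at :: "'a set set \<Rightarrow> 'a \<Rightarrow> nat" where
  "ord_at \<V> x = card {V\<in>\<V>. x \<in> V} - 1"

definition ord_dyn :: "'a topology \<Rightarrow> ('a \<Rightarrow> 'a) \<Rightarrow> 'a set set \<Rightarrow> ennreal" where
  "ord_dyn X T \<V> = (SUP \<mu>\<in>inv_prob X T. \<integral>\<^sup>+ x. of_nat (ord_at \<V> x) \<partial>\<mu>)"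

definition dim_cover :: "'a topology \<Rightarrow> ('a \<Rightarrow> 'a) \<Rightarrow> 'a set set \<Rightarrow> ennreal" where
  "dim_cover X T \<U> = (INF \<V>\<in>{\<V>\<in>Cov X. refines \<V> \<U>}. ord_dyn X T \<V>)"

definition dyn_dim :: "'a topology \<Rightarrow> ('a \<Rightarrow> 'a) \<Rightarrow> ennreal" where
  "dyn_dim X T = (SUP \<U>\<in>Cov X. dim_cover X T \<U>)"

end

(* Embedding into a cubical shift bounds the dimension: refine a given cover by cells cut out by
   finitely many coordinates x_{k,i}. A point lies in at most one cell more than it has coordinates
   near a cut. If the cuts of the i-th coordinate at different times k are disjoint, invariance
   bounds the measures of the events "x_{k,i} is near a cut", summed over k, by 1, so the mean
   order is at most n whatever the window.

   Conversely let dim(X,T) < D. A fine cover has a closed shrinking whose order, averaged over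
   orbit segments of some length N, is at most D, since otherwise empirical measures would
   accumulate at an invariant measure of too large mean order. Let n = 2D + 7, let u be a
   continuous function, and let x, y satisfy u x <= 0 and u y >= 1. Interpolate g : X -> R^n by a
   partition of unity (phi_v) of the fine cover and add
   sum_{k<N} beta_{s,k} r_{s,k}(u(T^{-k} z)) to the coordinate s, where the ramps r_{s,k} have
   disjoint transition intervals. At a suitable time j < N, more coordinates s have all ramps
   equal to 0 or 1 at T^j x and at T^j y than there are indices v active at T^j x or T^j y. Since
   r_{s,j} distinguishes x from y, equality of the coordinates at T^j x and T^j y would put a
   nonzero linear combination of the beta_{s,k} into a proper subspace, which generic beta avoid.
   Thus small perturbations of g separate all such pairs, and a limit of successive perturbations
   separates all pairs of points. *)
theory Submission
  imports Defs
begin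

section \<open>Invariant measures from finitely additive contents\<close>

locale normalized_content =
  fixes X :: "'a topology" and m :: "'a set \<Rightarrow> real"
  assumes compact: "compact_space X" and Hausdorff: "Hausdorff_space X"
    and nonneg: "\<And>E. 0 \<le> m E"
    and additive: "\<And>A B. A \<inter> B = {} \<Longrightarrow> m (A \<union> B) = m A + m B"
    and normalized: "m (topspace X) = 1"
begin

lemma content_mono: "A \<subseteq> B \<Longrightarrow> m A \<le> m B"
  using additive[of A "B - A"] nonneg[of "B - A"] by (simp add: Un_absorb1)

lemma content_empty: "m {} = 0"
  using additive[of "{}" "{}"] by simp

lemma content_Un_le: "m (A \<union> B) \<le> m A + m B"
  using additive[of A "B - A"] content_mono[of "B - A" B] by auto

text \<open>The Riesz construction, run on a finitely additive content of all subsets instead of a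
  positive functional: inner regularity by closed sets, then outer regularity by open sets.\<close>

definition inner_content :: "'a set \<Rightarrow> ennreal" where
  "inner_content U = (SUP K\<in>{K. closedin X K \<and> K \<subseteq> U}. ennreal (m K))"

definition outer_content :: "'a set \<Rightarrow> ennreal" where
  "outer_content E = (INF U\<in>{U. openin X U \<and> E \<subseteq> U}. inner_content U)"

lemma inner_content_mono: "A \<subseteq> B \<Longrightarrow> inner_content A \<le> inner_content B"
  unfolding inner_content_def by (rule SUP_subset_mono) auto

lemma inner_content_upper: "closedin X K \<Longrightarrow> K \<subseteq> U \<Longrightarrow> ennreal (m K) \<le> inner_content U"
  unfolding inner_content_def by (rule SUP_upper) auto

lemma inner_content_empty: "inner_content {} = 0"
proof -
  have "{K. closedin X K \<and> K \<subseteq> {}} = {{}}"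
    by auto
  then show ?thesis by (simp add: inner_content_def content_empty)
qed

lemma inner_content_Un_le:
  assumes "openin X U" "openin X V"
  shows "inner_content (U \<union> V) \<le> inner_content U + inner_content V"
  unfolding inner_content_def[of "U \<union> V"]
proof (rule SUP_least)
  fix K assume "K \<in> {K. closedin X K \<and> K \<subseteq> U \<union> V}"
  then have K: "closedin X K" "K \<subseteq> U \<union> V" by auto
  have normal: "normal_space X"
    by (simp add: compact Hausdorff compact_Hausdorff_or_regular_imp_normal_space)
  have "closedin X (K - U)" "K - U \<subseteq> V"
    using K assms by auto
  then obtain W where W: "openin X W" "K - U \<subseteq> W" "X closure_of W \<subseteq> V"
    using normal[unfolded normal_space_alt, rule_format, of "K - U" V] assms(2) by auto
  let ?K1 = "K - W" and ?K2 = "K \<inter> X closure_of W"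
  have sub: "K \<subseteq> ?K1 \<union> ?K2"
    using K closedin_subset[OF K(1)] closure_of_subset[of W X] openin_subset[OF W(1)] by blast
  have "m K \<le> m ?K1 + m ?K2"
    using content_mono[OF sub] content_Un_le[of ?K1 ?K2] by linarith
  then have "ennreal (m K) \<le> ennreal (m ?K1) + ennreal (m ?K2)"
    by (simp add: ennreal_leI nonneg flip: ennreal_plus)
  also have "\<dots> \<le> inner_content U + inner_content V"
  proof (rule add_mono)
    show "ennreal (m ?K1) \<le> inner_content U"
      using K W(2) closedin_diff[OF K(1) W(1)] by (intro inner_content_upper) blast+
    show "ennreal (m ?K2) \<le> inner_content V"
      using W(3) closedin_Int[OF K(1) closedin_closure_of[of X W]] by (intro inner_content_upper) blast+
  qed
  finally show "ennreal (m K) \<le> inner_content U + inner_content V" .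
qed

lemma inner_content_UN_finite_le:
  assumes "\<And>i. openin X (U i)"
  shows "inner_content (\<Union>i<n. U i) \<le> (\<Sum>i<(n::nat). inner_content (U i))"
proof (induction n)
  case 0
  then show ?case by (simp add: inner_content_empty)
next
  case (Suc n)
  have "inner_content (\<Union>i<Suc n. U i) = inner_content ((\<Union>i<n. U i) \<union> U n)"
    by (simp add: lessThan_Suc Un_commute)
  also have "\<dots> \<le> inner_content (\<Union>i<n. U i) + inner_content (U n)"
    using assms by (intro inner_content_Un_le) auto
  also have "\<dots> \<le> (\<Sum>i<Suc n. inner_content (U i))"
    using Suc by (simp add: add_mono)
  finally show ?case .
qed

lemma inner_content_UN_le:
  assumes "\<And>i. openin X (U i)"
  shows "inner_content (\<Union>i. U i) \<le> (\<Sum>i::nat. inner_content (U i))"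
  unfolding inner_content_def[of "\<Union>i. U i"]
proof (rule SUP_least)
  fix K assume "K \<in> {K. closedin X K \<and> K \<subseteq> (\<Union>i. U i)}"
  then have K: "closedin X K" "K \<subseteq> (\<Union>i. U i)" by auto
  have "compactin X K"
    using K compact by (simp add: closedin_compact_space)
  then obtain \<F> where \<F>: "finite \<F>" "\<F> \<subseteq> range U" "K \<subseteq> \<Union>\<F>"
    using K assms unfolding compactin_def by (metis (no_types, lifting) imageE)
  then obtain I where I: "finite I" "\<F> = U ` I"
    by (meson finite_subset_image)
  obtain n where n: "I \<subseteq> {..<n}"
    using I(1) finite_nat_iff_bounded by blast
  have "K \<subseteq> (\<Union>i<n. U i)" using \<F> I n by blast
  then have "ennreal (m K) \<le> inner_content (\<Union>i<n. U i)"
    using K by (intro inner_content_upper)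
  also have "\<dots> \<le> (\<Sum>i<n. inner_content (U i))"
    using assms by (rule inner_content_UN_finite_le)
  also have "\<dots> \<le> (\<Sum>i. inner_content (U i))"
    by (intro sum_le_suminf) auto
  finally show "ennreal (m K) \<le> (\<Sum>i. inner_content (U i))" .
qed

lemma outer_content_open: "openin X U \<Longrightarrow> outer_content U = inner_content U"
  unfolding outer_content_def
  by (intro antisym INF_greatest INF_lower) (auto intro: inner_content_mono)

lemma outer_content_mono: "A \<subseteq> B \<Longrightarrow> outer_content A \<le> outer_content B"
  unfolding outer_content_def by (rule INF_superset_mono) auto

lemma outer_content_close:
  assumes "outer_content E < e"
  obtains U where "openin X U" "E \<subseteq> U" "inner_content U < e"
  using assms unfolding outer_content_def INF_less_iff by auto

lemma inner_content_le_1: "inner_content U \<le> 1"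
  unfolding inner_content_def
proof (rule SUP_least)
  fix K assume "K \<in> {K. closedin X K \<and> K \<subseteq> U}"
  then have "m K \<le> 1"
    using content_mono[of K "topspace X"] closedin_subset normalized by auto
  then show "ennreal (m K) \<le> 1" by simp
qed

lemma outer_content_le_1: "E \<subseteq> topspace X \<Longrightarrow> outer_content E \<le> 1"
  unfolding outer_content_def
  by (rule INF_lower2[of "topspace X"]) (auto simp: inner_content_le_1)

lemma outer_measure_space_outer_content: "outer_measure_space (Pow (topspace X)) outer_content"
  unfolding outer_measure_space_def
proof (intro conjI)
  show "positive (Pow (topspace X)) outer_content"
    by (simp add: positive_def outer_content_open inner_content_empty)
  show "increasing (Pow (topspace X)) outer_content"
    by (simp add: increasing_def outer_content_mono)
  show "countably_subadditive (Pow (topspace X)) outer_content"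
    unfolding countably_subadditive_def
  proof (intro allI impI)
    fix A :: "nat \<Rightarrow> 'a set"
    assume A: "range A \<subseteq> Pow (topspace X)"
    show "outer_content (\<Union>i. A i) \<le> (\<Sum>i. outer_content (A i))"
    proof (rule ennreal_le_epsilon)
      fix e :: real assume "0 < e"
      have "outer_content (A n) < outer_content (A n) + e * (1/2)^Suc n" for n
      proof -
        have "outer_content (A n) < top"
          using A by (intro le_less_trans[OF outer_content_le_1]) auto
        then show ?thesis using \<open>0 < e\<close> by auto
      qed
      then have "\<exists>U. openin X U \<and> A n \<subseteq> U \<and> inner_content U < outer_content (A n) + e * (1/2)^Suc n" for n
        by (metis outer_content_close)
      then obtain U where U: "\<And>n. openin X (U n)" "\<And>n. A n \<subseteq> U n"
        "\<And>n. inner_content (U n) < outer_content (A n) + e * (1/2)^Suc n"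
        by metis
      have "outer_content (\<Union>i. A i) \<le> outer_content (\<Union>i. U i)"
        using U by (intro outer_content_mono) blast
      also have "\<dots> = inner_content (\<Union>i. U i)"
        using U by (intro outer_content_open) auto
      also have "\<dots> \<le> (\<Sum>i. inner_content (U i))"
        using U by (intro inner_content_UN_le)
      also have "\<dots> \<le> (\<Sum>n. outer_content (A n) + e * (1/2) ^ Suc n)"
        using U(3) by (intro suminf_le allI) (auto intro: less_imp_le)
      also have "\<dots> = (\<Sum>n. outer_content (A n)) + (\<Sum>n. ennreal e * ennreal ((1/2) ^ Suc n))"
        using \<open>0 < e\<close> by (subst suminf_add[symmetric])
          (auto simp del: ennreal_suminf_cmult simp add: ennreal_mult[symmetric])
      also have "\<dots> = (\<Sum>n. outer_content (A n)) + e"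
        unfolding ennreal_suminf_cmult
        by (subst suminf_ennreal_eq[OF zero_le_power power_half_series]) auto
      finally show "outer_content (\<Union>i. A i) \<le> (\<Sum>n. outer_content (A n)) + e" .
    qed
  qed
qed

lemma inner_content_split:
  assumes U: "openin X U" and V: "openin X V"
  shows "outer_content (V \<inter> U) + outer_content (V - U) \<le> inner_content V"
proof -
  have "ennreal (m K) + outer_content (V - U) \<le> inner_content V"
    if K: "closedin X K" "K \<subseteq> V \<inter> U" for K
  proof -
    have op: "openin X (V - K)" using V K by auto
    have "outer_content (V - U) \<le> outer_content (V - K)"
      using K by (intro outer_content_mono) auto
    also have "\<dots> = inner_content (V - K)" using op by (rule outer_content_open)
    finally have "ennreal (m K) + outer_content (V - U) \<le> ennreal (m K) + inner_content (V - K)"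
      by (rule add_left_mono)
    also have "\<dots> = (SUP L\<in>{L. closedin X L \<and> L \<subseteq> V - K}. ennreal (m K) + ennreal (m L))"
      unfolding inner_content_def
      by (rule ennreal_SUP_add_right) auto
    also have "\<dots> \<le> inner_content V"
    proof (rule SUP_least)
      fix L assume "L \<in> {L. closedin X L \<and> L \<subseteq> V - K}"
      then have L: "closedin X L" "L \<subseteq> V" "K \<inter> L = {}" by auto
      have "ennreal (m K) + ennreal (m L) = ennreal (m (K \<union> L))"
        using L additive nonneg by (simp add: ennreal_plus)
      also have "\<dots> \<le> inner_content V"
        using K L by (intro inner_content_upper) auto
      finally show "ennreal (m K) + ennreal (m L) \<le> inner_content V" .
    qed
    finally show ?thesis .
  qed
  then have "(SUP K\<in>{K. closedin X K \<and> K \<subseteq> V \<inter> U}. ennreal (m K) + outer_content (V - U)) \<le> inner_content V"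
    by (intro SUP_least) auto
  moreover have "(SUP K\<in>{K. closedin X K \<and> K \<subseteq> V \<inter> U}. ennreal (m K) + outer_content (V - U))
      = inner_content (V \<inter> U) + outer_content (V - U)"
    unfolding inner_content_def by (rule ennreal_SUP_add_left) auto
  moreover have "outer_content (V \<inter> U) = inner_content (V \<inter> U)"
    using U V by (intro outer_content_open) auto
  ultimately show ?thesis by simp
qed

lemma open_in_lambda_system:
  assumes "openin X U"
  shows "U \<in> lambda_system (topspace X) (Pow (topspace X)) outer_content"
proof -
  have "outer_content (U \<inter> E) + outer_content ((topspace X - U) \<inter> E) = outer_content E"
    if "E \<subseteq> topspace X" for E
  proof (rule antisym)
    show "outer_content (U \<inter> E) + outer_content ((topspace X - U) \<inter> E) \<le> outer_content E"
      unfolding outer_content_def[of E]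
    proof (rule INF_greatest)
      fix V assume "V \<in> {V. openin X V \<and> E \<subseteq> V}"
      then have V: "openin X V" "E \<subseteq> V" by auto
      have "outer_content (U \<inter> E) + outer_content ((topspace X - U) \<inter> E)
          \<le> outer_content (V \<inter> U) + outer_content (V - U)"
        using V by (intro add_mono outer_content_mono) auto
      also have "\<dots> \<le> inner_content V"
        using assms V(1) by (rule inner_content_split)
      finally show "outer_content (U \<inter> E) + outer_content ((topspace X - U) \<inter> E) \<le> inner_content V" .
    qed
    have "outer_content E \<le> outer_content ((U \<inter> E) \<union> ((topspace X - U) \<inter> E))"
      using that by (intro outer_content_mono) auto
    also have "\<dots> \<le> outer_content (U \<inter> E) + outer_content ((topspace X - U) \<inter> E)"
    proof -
      have "subadditive (Pow (topspace X)) outer_content"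
        using outer_measure_space_outer_content
        by (intro ring_of_sets.countably_subadditive_subadditive[OF ring_of_sets_Pow])
          (auto simp: outer_measure_space_def)
      then show ?thesis
        using that openin_subset[OF assms] by (intro subadditiveD) auto
    qed
    finally show "outer_content E \<le> outer_content (U \<inter> E) + outer_content ((topspace X - U) \<inter> E)" .
  qed
  then show ?thesis
    using openin_subset[OF assms] by (auto simp: lambda_system_def)
qed

definition content_measure :: "'a measure" where
  "content_measure = measure_of (topspace X) {U. openin X U} outer_content"

lemma sets_content_measure: "sets content_measure = sigma_sets (topspace X) {U. openin X U}"
  unfolding content_measure_def by (rule sets_measure_of) (auto dest: openin_subset)

lemma space_content_measure: "space content_measure = topspace X"
  unfolding content_measure_def by (rule space_measure_of) (auto dest: openin_subset)

lemma emeasure_content_measure: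
  assumes "E \<in> sets content_measure"
  shows "emeasure content_measure E = outer_content E"
proof -
  let ?L = "lambda_system (topspace X) (Pow (topspace X)) outer_content"
  have "measure_space (topspace X) ?L outer_content"
    by (rule sigma_algebra.caratheodory_lemma[OF sigma_algebra_Pow outer_measure_space_outer_content])
  moreover have "sigma_sets (topspace X) {U. openin X U} \<subseteq> ?L"
    using calculation open_in_lambda_system
    by (intro sigma_algebra.sigma_sets_subset) (auto simp: measure_space_def)
  moreover have "sigma_algebra (topspace X) (sigma_sets (topspace X) {U. openin X U})"
    by (rule sigma_algebra_sigma_sets) (use openin_subset in blast)
  ultimately have "measure_space (topspace X) (sigma_sets (topspace X) {U. openin X U}) outer_content"
    using measure_down by blast
  then show ?thesis
    using assms unfolding sets_content_measure
    by (intro emeasure_measure_of[OF content_measure_def])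
      (auto simp: measure_space_def sets_content_measure dest: openin_subset)
qed

lemma prob_space_content_measure: "prob_space content_measure"
proof
  have "topspace X \<in> sets content_measure"
    by (simp add: sets_content_measure sigma_sets_top)
  moreover have "inner_content (topspace X) \<ge> ennreal (m (topspace X))"
    by (rule inner_content_upper) auto
  ultimately show "emeasure content_measure (space content_measure) = 1"
    using inner_content_le_1[of "topspace X"] normalized
    by (simp add: space_content_measure emeasure_content_measure outer_content_open)
qed

lemma content_measure_upper:
  assumes "closedin X K" "openin X U" "K \<subseteq> U"
  shows "ennreal (m K) \<le> emeasure content_measure U"
  using assms inner_content_upper[of K U]
  by (simp add: emeasure_content_measure sets_content_measure outer_content_open)

lemma content_measure_inv_prob:
  assumes T: "homeomorphic_map X X T"
    and inv: "\<And>E. E \<subseteq> topspace X \<Longrightarrow> m (T -` E \<inter> topspace X) = m E"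
  shows "content_measure \<in> inv_prob X T"
proof -
  have cont: "continuous_map X X T" and inj: "inj_on T (topspace X)" and surj: "T ` topspace X = topspace X"
    using T by (auto simp: homeomorphic_eq_everything_map)
  have opn: "openin X (T ` U)" if "openin X U" for U
    using T that by (meson homeomorphic_imp_open_map open_map_def)
  have cls: "closedin X (T ` U)" if "closedin X U" for U
    using T that by (meson homeomorphic_imp_closed_map closed_map_def)
  have pre_open: "openin X (T -` U \<inter> topspace X)" if "openin X U" for U
    using openin_continuous_map_preimage[OF cont that] by (simp add: vimage_def Int_def conj_commute)
  have pre_closed: "closedin X (T -` U \<inter> topspace X)" if "closedin X U" for U
    using closedin_continuous_map_preimage[OF cont that] by (simp add: vimage_def Int_def conj_commute)
  have pre_image: "T -` (T ` U) \<inter> topspace X = U" if "U \<subseteq> topspace X" for U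
    using inj that by (auto dest: inj_onD)
  have image_pre: "T ` (T -` U \<inter> topspace X) = U" if "U \<subseteq> topspace X" for U
  proof -
    have "T ` (T -` U \<inter> topspace X) = U \<inter> T ` topspace X" by auto
    then show ?thesis using surj that by auto
  qed
  have inner: "inner_content (T -` U \<inter> topspace X) = inner_content U" if "openin X U" for U
  proof (rule antisym)
    show "inner_content (T -` U \<inter> topspace X) \<le> inner_content U"
      unfolding inner_content_def[of "T -` U \<inter> topspace X"]
    proof (rule SUP_least)
      fix K assume "K \<in> {K. closedin X K \<and> K \<subseteq> T -` U \<inter> topspace X}"
      then have K: "closedin X K" "T ` K \<subseteq> U" "K \<subseteq> topspace X" by auto
      have "m (T ` K) = m K"
        using inv[of "T ` K"] pre_image[of K] K(3) image_mono[OF K(3), of T] surj by simp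
      then show "ennreal (m K) \<le> inner_content U"
        using inner_content_upper[OF cls[OF K(1)] K(2)] by simp
    qed
    show "inner_content U \<le> inner_content (T -` U \<inter> topspace X)"
      unfolding inner_content_def[of U]
    proof (rule SUP_least)
      fix K assume "K \<in> {K. closedin X K \<and> K \<subseteq> U}"
      then have K: "closedin X K" "K \<subseteq> U" by auto
      then show "ennreal (m K) \<le> inner_content (T -` U \<inter> topspace X)"
        using inner_content_upper[OF pre_closed[OF K(1)], of "T -` U \<inter> topspace X"]
          inv[of K] closedin_subset[OF K(1)] by auto
    qed
  qed
  have outer: "outer_content (T -` E \<inter> topspace X) = outer_content E" if "E \<subseteq> topspace X" for E
  proof (rule antisym)
    show "outer_content (T -` E \<inter> topspace X) \<le> outer_content E"
      unfolding outer_content_def[of E]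
    proof (rule INF_greatest)
      fix U assume "U \<in> {U. openin X U \<and> E \<subseteq> U}"
      then have U: "openin X U" "E \<subseteq> U" by auto
      have "outer_content (T -` E \<inter> topspace X) \<le> outer_content (T -` U \<inter> topspace X)"
        using U by (intro outer_content_mono) auto
      then show "outer_content (T -` E \<inter> topspace X) \<le> inner_content U"
        by (simp add: inner[OF U(1)] outer_content_open[OF pre_open[OF U(1)]])
    qed
    show "outer_content E \<le> outer_content (T -` E \<inter> topspace X)"
      unfolding outer_content_def[of "T -` E \<inter> topspace X"]
    proof (rule INF_greatest)
      fix U assume "U \<in> {U. openin X U \<and> T -` E \<inter> topspace X \<subseteq> U}"
      then have U: "openin X U" "T -` E \<inter> topspace X \<subseteq> U" by auto
      have "E \<subseteq> T ` U"
        using U(2) image_pre[OF that] by blast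
      then have "outer_content E \<le> outer_content (T ` U)"
        by (rule outer_content_mono)
      also have "\<dots> = inner_content (T ` U)"
        using opn[OF U(1)] by (rule outer_content_open)
      also have "\<dots> = inner_content U"
        using inner[OF opn[OF U(1)]] pre_image[OF openin_subset[OF U(1)]] by simp
      finally show "outer_content E \<le> inner_content U" .
    qed
  qed
  have sets_eq: "sets content_measure = sets (borel_of X)"
    unfolding borel_of_def sets_content_measure
    by (rule sets_measure_of[symmetric]) (auto dest: openin_subset)
  have meas: "T \<in> measurable content_measure content_measure"
  proof (rule measurable_sigma_sets[OF sets_content_measure])
    show "{U. openin X U} \<subseteq> Pow (topspace X)" by (auto dest: openin_subset)
    show "T \<in> space content_measure \<rightarrow> topspace X"
      using surj by (auto simp: space_content_measure)
    show "T -` U \<inter> space content_measure \<in> sets content_measure" if "U \<in> {U. openin X U}" for U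
      using that pre_open by (auto simp: space_content_measure sets_content_measure)
  qed
  have "emeasure content_measure (T -` A \<inter> space content_measure) = emeasure content_measure A"
    if "A \<in> sets content_measure" for A
  proof -
    have "A \<subseteq> topspace X"
      using sets.sets_into_space[OF that] by (simp add: space_content_measure)
    then show ?thesis
      using outer[of A] measurable_sets[OF meas that]
      by (simp add: emeasure_content_measure that space_content_measure)
  qed
  then show ?thesis
    by (simp add: inv_prob_def sets_eq prob_space_content_measure)
qed

end

lemma inv_prob_sets_space:
  assumes "\<mu> \<in> inv_prob X T"
  shows "sets \<mu> = sigma_sets (topspace X) {U. openin X U}" "space \<mu> = topspace X"
proof -
  have sub: "{U. openin X U} \<subseteq> Pow (topspace X)" by (auto dest: openin_subset)
  have eq: "sets \<mu> = sets (borel_of X)" using assms by (simp add: inv_prob_def)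
  show "sets \<mu> = sigma_sets (topspace X) {U. openin X U}"
    unfolding eq borel_of_def using sub by (rule sets_measure_of)
  show "space \<mu> = topspace X"
    using sets_eq_imp_space_eq[OF eq] space_measure_of[OF sub] by (simp add: borel_of_def)
qed

lemma cluster_point_in_cube:
  fixes e :: "nat \<Rightarrow> 'b \<Rightarrow> real"
  assumes e: "\<And>n b. e n b \<in> {0..1}"
  obtains m where "\<And>P. closed P \<Longrightarrow> eventually (\<lambda>n. e n \<in> P) sequentially \<Longrightarrow> m \<in> P"
proof -
  let ?K = "PiE UNIV (\<lambda>_. {0..1}) :: ('b \<Rightarrow> real) set"
  let ?F = "\<lambda>n. closure (e ` {n..})"
  have "compactin (product_topology (\<lambda>_. euclidean) UNIV) ?K"
    by (subst compactin_PiE) auto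
  then have compact: "compact ?K"
    by (simp add: euclidean_product_topology flip: compactin_euclidean_iff)
  have "?K \<inter> \<Inter>(range ?F) \<noteq> {}"
  proof (rule compact_imp_fip[OF compact])
    show "closed S" if "S \<in> range ?F" for S using that by auto
    show "?K \<inter> \<Inter>\<F> \<noteq> {}" if \<F>: "finite \<F>" "\<F> \<subseteq> range ?F" for \<F>
    proof -
      obtain I where I: "finite I" "\<F> = ?F ` I"
        using finite_subset_image[OF \<F>] by auto
      obtain n where n: "\<And>i. i \<in> I \<Longrightarrow> i < n"
        using I(1) unfolding finite_nat_set_iff_bounded by metis
      have "e n \<in> ?F i" if "i \<in> I" for i
        using n[OF that] by (intro subsetD[OF closure_subset]) auto
      moreover have "e n \<in> ?K" using e by auto
      ultimately show ?thesis using I(2) by blast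
    qed
  qed
  then obtain m where m: "\<And>n. m \<in> ?F n" by blast
  show thesis
  proof (rule that)
    fix P :: "('b \<Rightarrow> real) set" assume P: "closed P" "eventually (\<lambda>n. e n \<in> P) sequentially"
    then obtain n where "e ` {n..} \<subseteq> P" by (auto simp: eventually_sequentially)
    then show "m \<in> P" using closure_minimal P(1) m[of n] by blast
  qed
qed

lemma top_dyn_system_funpow:
  assumes "top_dyn_system X T" "x \<in> topspace X"
  shows "(T ^^ j) x \<in> topspace X"
proof -
  have "T ` topspace X = topspace X"
    using assms(1) by (simp add: top_dyn_system_def homeomorphic_eq_everything_map)
  then show ?thesis using assms(2) by (induction j) auto
qed

lemma invariant_measure_from_orbits:
  fixes K U :: "'i \<Rightarrow> 'a set"
  assumes X: "top_dyn_system X T"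
    and fin: "finite I"
    and K: "\<And>v. v \<in> I \<Longrightarrow> closedin X (K v)" and U: "\<And>v. v \<in> I \<Longrightarrow> openin X (U v)"
    and sub: "\<And>v. v \<in> I \<Longrightarrow> K v \<subseteq> U v"
    and c: "0 \<le> c"
    and orbits: "\<And>N::nat. N > 0 \<Longrightarrow> \<exists>x\<in>topspace X. c * real N \<le> (\<Sum>j<N. real (card {v\<in>I. (T ^^ j) x \<in> K v}))"
  shows "\<exists>\<mu>\<in>inv_prob X T. ennreal c \<le> (\<Sum>v\<in>I. emeasure \<mu> (U v))"
proof -
  have "\<forall>n. \<exists>x. x \<in> topspace X \<and> c * real (Suc n) \<le> (\<Sum>j<Suc n. real (card {v\<in>I. (T ^^ j) x \<in> K v}))"
    using orbits[OF zero_less_Suc] by (auto simp del: of_nat_Suc sum.lessThan_Suc)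
  then obtain x where x: "\<And>n. x n \<in> topspace X"
    "\<And>n. c * real (Suc n) \<le> (\<Sum>j<Suc n. real (card {v\<in>I. (T ^^ j) (x n) \<in> K v}))"
    unfolding choice_iff by blast
  define e :: "nat \<Rightarrow> 'a set \<Rightarrow> real"
    where "e n E = (\<Sum>j<Suc n. of_bool ((T ^^ j) (x n) \<in> E)) / real (Suc n)" for n E
  have orb: "(T ^^ j) (x n) \<in> topspace X" for j n
    using top_dyn_system_funpow[OF X x(1)] .
  have e01: "e n E \<in> {0..1}" for n E
  proof -
    have "(\<Sum>j<Suc n. of_bool ((T ^^ j) (x n) \<in> E)) \<le> (\<Sum>j<Suc n. 1::real)"
      by (rule sum_mono) auto
    then show ?thesis
      unfolding e_def by (auto simp: field_simps simp del: sum.lessThan_Suc intro!: divide_nonneg_nonneg sum_nonneg)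
  qed
  obtain m where m: "\<And>P. closed P \<Longrightarrow> eventually (\<lambda>n. e n \<in> P) sequentially \<Longrightarrow> m \<in> P"
    using cluster_point_in_cube[of e] e01 by blast
  have m_nonneg: "0 \<le> m E" for E
  proof -
    have "m \<in> {f. 0 \<le> f E}"
      by (rule m) (use e01 in \<open>auto intro!: closed_Collect_le\<close>)
    then show ?thesis by simp
  qed
  have m_add: "m (A \<union> B) = m A + m B" if "A \<inter> B = {}" for A B
  proof -
    have "e n (A \<union> B) = e n A + e n B" for n
    proof -
      have "of_bool (z \<in> A \<union> B) = (of_bool (z \<in> A) + of_bool (z \<in> B) :: real)" for z
        using that by auto
      then show ?thesis by (simp add: e_def sum.distrib add_divide_distrib del: Un_iff sum.lessThan_Suc of_nat_Suc)
    qed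
    then have "m \<in> {f. f (A \<union> B) = f A + f B}"
      by (intro m) (auto intro!: closed_Collect_eq continuous_on_add)
    then show ?thesis by simp
  qed
  have m_norm: "m (topspace X) = 1"
  proof -
    have "m \<in> {f. f (topspace X) = 1}"
      by (rule m) (auto simp: e_def orb simp del: sum.lessThan_Suc of_nat_Suc intro!: closed_Collect_eq)
    then show ?thesis by simp
  qed
  have m_inv: "m (T -` E \<inter> topspace X) = m E" for E
  proof -
    let ?A = "T -` E \<inter> topspace X"
    have diff: "\<bar>e n ?A - e n E\<bar> \<le> 1 / real (Suc n)" for n
    proof -
      let ?a = "\<lambda>j. of_bool ((T ^^ j) (x n) \<in> E) :: real"
      have "e n ?A - e n E = (\<Sum>j<Suc n. ?a (Suc j) - ?a j) / real (Suc n)"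
        by (simp add: e_def orb diff_divide_distrib sum_subtractf del: sum.lessThan_Suc of_nat_Suc)
      also have "(\<Sum>j<Suc n. ?a (Suc j) - ?a j) = ?a (Suc n) - ?a 0"
        by (rule sum_lessThan_telescope)
      finally have "e n ?A - e n E = (?a (Suc n) - ?a 0) / real (Suc n)" .
      moreover have "\<bar>?a (Suc n) - ?a 0\<bar> \<le> 1" by auto
      ultimately show ?thesis by (simp only: abs_divide abs_of_nat divide_right_mono of_nat_0_le_iff)
    qed
    have "\<bar>m ?A - m E\<bar> \<le> \<epsilon>" if \<epsilon>: "\<epsilon> > 0" for \<epsilon>
    proof -
      obtain n0 where n0: "1 / real (Suc n0) < \<epsilon>"
        using nat_approx_posE[OF \<epsilon>] by blast
      have "\<bar>e n ?A - e n E\<bar> \<le> \<epsilon>" if "n \<ge> n0" for n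
      proof -
        have "1 / real (Suc n) \<le> 1 / real (Suc n0)" using that by (simp add: divide_simps)
        then show ?thesis using diff[of n] n0 by linarith
      qed
      then have "eventually (\<lambda>n. e n \<in> {f. \<bar>f ?A - f E\<bar> \<le> \<epsilon>}) sequentially"
        by (auto simp: eventually_sequentially)
      moreover have "closed {f. \<bar>f ?A - f E :: real\<bar> \<le> \<epsilon>}"
        by (intro closed_Collect_le continuous_on_rabs continuous_on_diff) auto
      ultimately show ?thesis using m by blast
    qed
    then have "\<bar>m ?A - m E\<bar> \<le> 0"
      using field_le_epsilon[of "\<bar>m ?A - m E\<bar>" 0] by simp
    then show ?thesis by simp
  qed
  have m_sum: "c \<le> (\<Sum>v\<in>I. m (K v))"
  proof -
    have "c \<le> (\<Sum>v\<in>I. e n (K v))" for n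
    proof -
      have "real (card {v\<in>I. z \<in> K v}) = (\<Sum>v\<in>I. of_bool (z \<in> K v))" for z
        using fin by (simp add: of_bool_def sum.If_cases Int_def)
      then have "(\<Sum>j<Suc n. real (card {v\<in>I. (T ^^ j) (x n) \<in> K v}))
          = (\<Sum>v\<in>I. \<Sum>j<Suc n. of_bool ((T ^^ j) (x n) \<in> K v))"
        by (simp only: sum.swap[of _ I])
      then have "c * real (Suc n) \<le> (\<Sum>v\<in>I. e n (K v)) * real (Suc n)"
        using x(2)[of n] by (simp add: e_def del: sum.lessThan_Suc of_nat_Suc flip: sum_divide_distrib)
      then show ?thesis by simp
    qed
    then have "m \<in> {f. c \<le> (\<Sum>v\<in>I. f (K v))}"
      by (intro m) (auto intro!: closed_Collect_le continuous_on_sum)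
    then show ?thesis by simp
  qed
  interpret normalized_content X m
    using X m_nonneg m_add m_norm
    by unfold_locales (auto simp: top_dyn_system_def metrizable_imp_Hausdorff_space)
  have "content_measure \<in> inv_prob X T"
    using X m_inv by (intro content_measure_inv_prob) (auto simp: top_dyn_system_def)
  moreover have "ennreal c \<le> (\<Sum>v\<in>I. emeasure content_measure (U v))"
  proof -
    have "ennreal c \<le> ennreal (\<Sum>v\<in>I. m (K v))"
      using m_sum by (rule ennreal_leI)
    also have "\<dots> = (\<Sum>v\<in>I. ennreal (m (K v)))"
      using m_nonneg by (simp add: sum_ennreal)
    also have "\<dots> \<le> (\<Sum>v\<in>I. emeasure content_measure (U v))"
      using K U sub by (intro sum_mono content_measure_upper) auto
    finally show ?thesis .
  qed
  ultimately show ?thesis by blast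
qed

lemma Cov_partition_of_unity:
  assumes X: "compact_space X" "metrizable_space X" and V: "V \<in> Cov X"
  shows "\<exists>(\<phi> :: 'a set \<Rightarrow> 'a \<Rightarrow> real) K.
    (\<forall>v\<in>V. continuous_map X euclideanreal (\<phi> v) \<and> closedin X (K v) \<and> K v \<subseteq> v) \<and>
    (\<forall>v\<in>V. \<forall>x\<in>topspace X. 0 \<le> \<phi> v x \<and> (\<phi> v x \<noteq> 0 \<longrightarrow> x \<in> K v)) \<and>
    (\<forall>x\<in>topspace X. (\<Sum>v\<in>V. \<phi> v x) = 1)"
proof -
  have V': "finite V" "\<And>v. v \<in> V \<Longrightarrow> openin X v" "\<Union>V = topspace X"
    using V by (auto simp: Cov_def)
  have "\<forall>x. \<exists>v f. x \<in> topspace X \<longrightarrow> v \<in> V \<and> continuous_map X euclideanreal f \<and> f x = (0::real)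
      \<and> f ` (topspace X - v) \<subseteq> {1}"
  proof
    fix x
    show "\<exists>v f. x \<in> topspace X \<longrightarrow> v \<in> V \<and> continuous_map X euclideanreal f \<and> f x = (0::real)
      \<and> f ` (topspace X - v) \<subseteq> {1}"
    proof (cases "x \<in> topspace X")
      case True
      then obtain v where v: "v \<in> V" "x \<in> v" using V'(3) by auto
      then show ?thesis
        using metrizable_imp_completely_regular_space[OF X(2), unfolded completely_regular_space_alt',
            rule_format, OF V'(2)[OF v(1)] v(2)] by (intro exI[of _ v]) simp
    qed simp
  qed
  then obtain v f where vf: "\<forall>x. x \<in> topspace X \<longrightarrow> v x \<in> V \<and> continuous_map X euclideanreal (f x) \<and> f x x = (0::real)
      \<and> f x ` (topspace X - v x) \<subseteq> {1}"
    unfolding choice_iff by (elim exE)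
  then have f: "\<And>x. x \<in> topspace X \<Longrightarrow> v x \<in> V"
    "\<And>x. x \<in> topspace X \<Longrightarrow> continuous_map X euclideanreal (f x)"
    "\<And>x. x \<in> topspace X \<Longrightarrow> f x x = (0::real)"
    "\<And>x z. x \<in> topspace X \<Longrightarrow> z \<in> topspace X - v x \<Longrightarrow> f x z = 1"
    by (simp_all add: image_subset_iff)
  let ?B = "\<lambda>x. {z \<in> topspace X. f x z \<in> {..<1/4}}"
  have "openin X (?B x)" if "x \<in> topspace X" for x
    by (rule openin_continuous_map_preimage[OF f(2)[OF that]]) auto
  moreover have "topspace X \<subseteq> \<Union>(?B ` topspace X)" using f(3) by auto
  ultimately obtain \<F> where \<F>: "finite \<F>" "\<F> \<subseteq> ?B ` topspace X" "topspace X \<subseteq> \<Union>\<F>"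
    using X(1)[unfolded compact_space_alt, rule_format, of "?B ` topspace X"] by auto
  then obtain Y where Y: "finite Y" "Y \<subseteq> topspace X" "\<F> = ?B ` Y"
    using finite_subset_image[OF \<F>(1,2)] by auto
  define p where "p w z = (\<Sum>x\<in>{x\<in>Y. v x = w}. max (1/2 - f x z) 0)" for w z
  define s where "s z = (\<Sum>w\<in>V. p w z)" for z
  define K where "K w = (\<Union>x\<in>{x\<in>Y. v x = w}. {z \<in> topspace X. f x z \<in> {..1/2}})" for w
  have p_cont: "continuous_map X euclideanreal (p w)" for w
    unfolding p_def using f(2) Y
    by (intro continuous_map_sum continuous_map_real_max continuous_map_diff) auto
  have p_nonneg: "0 \<le> p w z" for w z
    unfolding p_def by (rule sum_nonneg) auto
  have s_pos: "0 < s z" if z: "z \<in> topspace X" for z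
  proof -
    obtain x where x: "x \<in> Y" "f x z < 1/4" using \<F>(3) Y(3) z by auto
    then have "v x \<in> V" using f(1) Y by auto
    have "0 < max (1/2 - f x z) 0" using x by auto
    also have "\<dots> \<le> p (v x) z"
      unfolding p_def by (rule member_le_sum) (use x Y in auto)
    also have "\<dots> \<le> s z"
      unfolding s_def by (rule member_le_sum) (use \<open>v x \<in> V\<close> V' p_nonneg in auto)
    finally show ?thesis .
  qed
  have s_cont: "continuous_map X euclideanreal s"
    unfolding s_def using V' p_cont by (intro continuous_map_sum) auto
  have "continuous_map X euclideanreal (\<lambda>z. p w z / s z)" for w
    using p_cont s_cont s_pos by (intro continuous_map_real_divide) force+
  moreover have "closedin X (K w)" for w
  proof -
    have "closedin X {z \<in> topspace X. f x z \<in> {..1/2}}" if "x \<in> Y" for x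
      using Y(2) that by (intro closedin_continuous_map_preimage[OF f(2)]) auto
    then show ?thesis
      unfolding K_def using Y(1) by (intro closedin_Union) auto
  qed
  moreover have "K w \<subseteq> w" for w
  proof
    fix z assume "z \<in> K w"
    then obtain x where x: "x \<in> Y" "v x = w" "z \<in> topspace X" "f x z \<le> 1/2"
      by (auto simp: K_def)
    then show "z \<in> w"
      using f(4)[of x z] Y(2) by (cases "z \<in> w") auto
  qed
  moreover have "0 \<le> p w z / s z" if "z \<in> topspace X" for w z
    using p_nonneg s_pos[OF that] by simp
  moreover have "z \<in> K w" if "p w z / s z \<noteq> 0" "z \<in> topspace X" for w z
  proof -
    have "p w z \<noteq> 0" using that by auto
    then obtain x where "x \<in> Y" "v x = w" "max (1/2 - f x z) 0 \<noteq> 0"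
      unfolding p_def by (auto elim!: sum.not_neutral_contains_not_neutral)
    then show ?thesis unfolding K_def using that by (auto simp: max_def split: if_splits)
  qed
  moreover have "(\<Sum>w\<in>V. p w z / s z) = 1" if "z \<in> topspace X" for z
    using s_pos[OF that] by (simp add: s_def flip: sum_divide_distrib)
  ultimately show ?thesis
    by (intro exI[of _ "\<lambda>w z. p w z / s z"] exI[of _ K] conjI ballI impI)
qed

lemma partition_of_unity_mean_order:
  assumes X: "top_dyn_system X T" and D: "dyn_dim X T < of_nat D" and \<U>: "\<U> \<in> Cov X"
  shows "\<exists>(V :: 'a set set) (\<phi> :: 'a set \<Rightarrow> 'a \<Rightarrow> real) N. finite V \<and> N > 0 \<and>
    (\<forall>v\<in>V. continuous_map X euclideanreal (\<phi> v)) \<and>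
    (\<forall>v\<in>V. \<forall>x\<in>topspace X. 0 \<le> \<phi> v x) \<and>
    (\<forall>x\<in>topspace X. (\<Sum>v\<in>V. \<phi> v x) = 1) \<and>
    (\<forall>v\<in>V. \<exists>u\<in>\<U>. \<forall>x\<in>topspace X. \<phi> v x \<noteq> 0 \<longrightarrow> x \<in> u) \<and>
    (\<forall>x\<in>topspace X. (\<Sum>j<N. card {v\<in>V. \<phi> v ((T ^^ j) x) \<noteq> 0}) \<le> (D + 1) * N)"
proof -
  have "dim_cover X T \<U> < of_nat D"
    using D \<U> unfolding dyn_dim_def by (meson SUP_upper le_less_trans)
  then obtain V where V: "V \<in> Cov X" "refines V \<U>" "ord_dyn X T V < of_nat D"
    unfolding dim_cover_def INF_less_iff by blast
  have cm: "compact_space X" "metrizable_space X" using X by (auto simp: top_dyn_system_def)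
  obtain \<phi> K where
    "(\<forall>v\<in>V. continuous_map X euclideanreal (\<phi> v) \<and> closedin X (K v) \<and> K v \<subseteq> v) \<and>
    (\<forall>v\<in>V. \<forall>x\<in>topspace X. 0 \<le> \<phi> v x \<and> (\<phi> v x \<noteq> 0 \<longrightarrow> x \<in> K v)) \<and>
    (\<forall>x\<in>topspace X. (\<Sum>v\<in>V. \<phi> v x) = 1)"
    using Cov_partition_of_unity[OF cm V(1)] by (elim exE)
  then have \<phi>: "\<And>v. v \<in> V \<Longrightarrow> continuous_map X euclideanreal (\<phi> v)"
    "\<And>v x. v \<in> V \<Longrightarrow> x \<in> topspace X \<Longrightarrow> 0 \<le> \<phi> v x"
    "\<And>x. x \<in> topspace X \<Longrightarrow> (\<Sum>v\<in>V. \<phi> v x) = 1"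
    "\<And>v x. v \<in> V \<Longrightarrow> x \<in> topspace X \<Longrightarrow> \<phi> v x \<noteq> 0 \<Longrightarrow> x \<in> K v"
    "\<And>v. v \<in> V \<Longrightarrow> closedin X (K v)" "\<And>v. v \<in> V \<Longrightarrow> K v \<subseteq> v"
    by simp_all
  have V': "finite V" "\<And>v. v \<in> V \<Longrightarrow> openin X v" "\<Union>V = topspace X"
    using V by (auto simp: Cov_def)
  have "\<exists>N>0. \<forall>x\<in>topspace X. (\<Sum>j<N. card {v\<in>V. \<phi> v ((T ^^ j) x) \<noteq> 0}) \<le> (D + 1) * N"
  proof (rule ccontr)
    assume contra: "\<not> ?thesis"
    have orb: "\<exists>x\<in>topspace X. real (D + 1) * real N \<le> (\<Sum>j<N. real (card {v\<in>V. (T ^^ j) x \<in> K v}))"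
      if N: "N > 0" for N
    proof -
      obtain x where x: "x \<in> topspace X" "(D + 1) * N < (\<Sum>j<N. card {v\<in>V. \<phi> v ((T ^^ j) x) \<noteq> 0})"
        using contra[simplified, rule_format, of N] N by auto
      note x(2)
      also have "(\<Sum>j<N. card {v\<in>V. \<phi> v ((T ^^ j) x) \<noteq> 0}) \<le> (\<Sum>j<N. card {v\<in>V. (T ^^ j) x \<in> K v})"
        using V'(1) \<phi>(4) top_dyn_system_funpow[OF X x(1)]
        by (intro sum_mono card_mono) auto
      finally have "real ((D + 1) * N) \<le> real (\<Sum>j<N. card {v\<in>V. (T ^^ j) x \<in> K v})"
        by (simp only: of_nat_le_iff less_imp_le)
      then show ?thesis using x(1) by (auto simp: algebra_simps)
    qed
    have "\<exists>\<mu>\<in>inv_prob X T. ennreal (real (D + 1)) \<le> (\<Sum>v\<in>V. emeasure \<mu> v)"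
      by (rule invariant_measure_from_orbits[OF X V'(1) \<phi>(5) V'(2) \<phi>(6) of_nat_0_le_iff orb])
    then obtain \<mu> where \<mu>: "\<mu> \<in> inv_prob X T" "ennreal (real (D + 1)) \<le> (\<Sum>v\<in>V. emeasure \<mu> v)"
      by (elim bexE)
    interpret prob_space \<mu> using \<mu>(1) by (simp add: inv_prob_def)
    note sets = inv_prob_sets_space(1)[OF \<mu>(1)] and space = inv_prob_sets_space(2)[OF \<mu>(1)]
    have meas [measurable]: "v \<in> sets \<mu>" if "v \<in> V" for v
      using V'(2)[OF that] by (simp add: sets)
    have ord: "of_nat (ord_at V x) + 1 = (\<Sum>v\<in>V. indicator v x :: ennreal)" if "x \<in> space \<mu>" for x
    proof -
      have "{v\<in>V. x \<in> v} \<noteq> {}" using that V'(3) space by blast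
      then have "card {v\<in>V. x \<in> v} > 0" using V'(1) by (simp add: card_gt_0_iff)
      then have "of_nat (ord_at V x) + 1 = (of_nat (card {v\<in>V. x \<in> v}) :: ennreal)"
        unfolding ord_at_def by (metis Suc_pred' add.commute of_nat_Suc diff_Suc_1 One_nat_def)
      also have "\<dots> = (\<Sum>v\<in>V. indicator v x)"
        using V'(1) by (simp add: indicator_def of_bool_def sum.If_cases Int_def)
      finally show ?thesis .
    qed
    have "(\<Sum>v\<in>V. emeasure \<mu> v) = (\<integral>\<^sup>+ x. (\<Sum>v\<in>V. indicator v x) \<partial>\<mu>)"
      by (subst nn_integral_sum) (auto simp: meas)
    also have "\<dots> = (\<integral>\<^sup>+ x. of_nat (ord_at V x) + 1 \<partial>\<mu>)"
      by (intro nn_integral_cong ord[symmetric])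
    also have "\<dots> \<le> (\<integral>\<^sup>+ x. of_nat (ord_at V x) \<partial>\<mu>) + 1"
    proof -
      have "(\<lambda>x. \<Sum>v\<in>V. indicator v x :: ennreal) \<in> borel_measurable \<mu>"
        by (intro borel_measurable_sum) auto
      then have "(\<lambda>x. of_nat (ord_at V x) + 1 :: ennreal) \<in> borel_measurable \<mu>"
        by (subst measurable_cong[OF ord])
      then have "(\<lambda>x. of_nat (ord_at V x) + 1 - 1 :: ennreal) \<in> borel_measurable \<mu>"
        by measurable
      then have "(\<lambda>x. of_nat (ord_at V x) :: ennreal) \<in> borel_measurable \<mu>"
        by (simp add: ennreal_add_diff_cancel_right)
      then show ?thesis by (simp add: nn_integral_add emeasure_space_1)
    qed
    also have "\<dots> \<le> ord_dyn X T V + 1"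
      unfolding ord_dyn_def by (intro add_right_mono SUP_upper \<mu>(1))
    also have "\<dots> < of_nat D + 1"
      using V(3) by (simp add: add.commute ennreal_add_left_cancel_less)
    also have "of_nat D + 1 = ennreal (real (D + 1))"
      by (metis ennreal_of_nat_eq_real_of_nat of_nat_1 of_nat_add)
    finally show False using \<mu>(2) by simp
  qed
  then obtain N where N: "N > 0" "\<forall>x\<in>topspace X. (\<Sum>j<N. card {v\<in>V. \<phi> v ((T ^^ j) x) \<noteq> 0}) \<le> (D + 1) * N"
    by (elim exE conjE)
  have "\<exists>u\<in>\<U>. \<forall>x\<in>topspace X. \<phi> v x \<noteq> 0 \<longrightarrow> x \<in> u" if "v \<in> V" for v
  proof -
    obtain u where "u \<in> \<U>" "v \<subseteq> u" using V(2) \<open>v \<in> V\<close> by (auto simp: refines_def)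
    then show ?thesis using \<phi>(4,6) \<open>v \<in> V\<close> by blast
  qed
  with V'(1) N \<phi>(1,2,3) show ?thesis
    by (intro exI[of _ V] exI[of _ \<phi>] exI[of _ N]) simp
qed

section \<open>General position\<close>

lemma exists_orthogonal_vector:
  fixes a :: "'w \<Rightarrow> 's \<Rightarrow> real"
  assumes "finite W" "finite S" "card W < card S"
  shows "\<exists>\<alpha>. (\<exists>s\<in>S. \<alpha> s \<noteq> 0) \<and> (\<forall>w\<in>W. (\<Sum>s\<in>S. \<alpha> s * a w s) = 0)"
  using assms
proof (induction W arbitrary: S a rule: finite_induct)
  case empty
  then obtain s where "s \<in> S" by fastforce
  then show ?case by (intro exI[of _ "\<lambda>_. 1"]) auto
next
  case (insert w0 W)
  show ?case
  proof (cases "\<exists>s0\<in>S. a w0 s0 \<noteq> 0")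
    case False
    have "card W < card S" using insert by simp
    then obtain \<alpha> where "\<exists>s\<in>S. \<alpha> s \<noteq> 0" "\<forall>w\<in>W. (\<Sum>s\<in>S. \<alpha> s * a w s) = 0"
      using insert.IH[OF insert.prems(1)] by blast
    then show ?thesis using False by (intro exI[of _ \<alpha>]) auto
  next
    case True
    then obtain s0 where s0: "s0 \<in> S" "a w0 s0 \<noteq> 0" by blast
    define S' where "S' = S - {s0}"
    have S': "finite S'" "card W < card S'" "S = insert s0 S'" "s0 \<notin> S'"
      using insert s0 by (auto simp: S'_def)
    obtain \<alpha>' where \<alpha>': "\<exists>s\<in>S'. \<alpha>' s \<noteq> 0"
      "\<forall>w\<in>W. (\<Sum>s\<in>S'. \<alpha>' s * (a w s - a w s0 / a w0 s0 * a w0 s)) = 0"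
      using insert.IH[OF S'(1,2), of "\<lambda>w s. a w s - a w s0 / a w0 s0 * a w0 s"] by blast
    define c where "c = - (\<Sum>s\<in>S'. \<alpha>' s * a w0 s) / a w0 s0"
    define \<alpha> where "\<alpha> s = (if s = s0 then c else \<alpha>' s)" for s
    have split: "(\<Sum>s\<in>S. \<alpha> s * f s) = c * f s0 + (\<Sum>s\<in>S'. \<alpha>' s * f s)" for f
    proof -
      have "(\<Sum>s\<in>S'. \<alpha> s * f s) = (\<Sum>s\<in>S'. \<alpha>' s * f s)"
        using S'(4) by (intro sum.cong) (auto simp: \<alpha>_def)
      then show ?thesis using S' by (simp add: \<alpha>_def)
    qed
    have "(\<Sum>s\<in>S. \<alpha> s * a w s) = 0" if "w \<in> insert w0 W" for w
    proof (cases "w = w0")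
      case True
      then show ?thesis using s0 by (simp add: split c_def)
    next
      case False
      then have "(\<Sum>s\<in>S'. \<alpha>' s * (a w s - a w s0 / a w0 s0 * a w0 s)) = 0"
        using \<alpha>'(2) that by auto
      then have "(\<Sum>s\<in>S'. \<alpha>' s * a w s) = a w s0 / a w0 s0 * (\<Sum>s\<in>S'. \<alpha>' s * a w0 s)"
        by (simp add: algebra_simps sum_subtractf sum_distrib_left)
      then show ?thesis using s0 by (simp add: split c_def)
    qed
    moreover have "\<exists>s\<in>S. \<alpha> s \<noteq> 0"
      using \<alpha>'(1) S' by (auto simp: \<alpha>_def)
    ultimately show ?thesis by blast
  qed
qed

lemma small_vector_off_hyperplanes:
  fixes L :: "('i \<Rightarrow> real) set"
  assumes "finite I" "finite L" "\<And>c. c \<in> L \<Longrightarrow> \<exists>i\<in>I. c i \<noteq> 0" "\<epsilon> > 0"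
  shows "\<exists>\<beta>. (\<forall>i\<in>I. \<bar>\<beta> i\<bar> < \<epsilon>) \<and> (\<forall>c\<in>L. (\<Sum>i\<in>I. c i * \<beta> i) \<noteq> 0)"
  using assms(2,3,4)
proof (induction L arbitrary: \<epsilon> rule: finite_induct)
  case empty
  then show ?case by (intro exI[of _ "\<lambda>_. 0"]) auto
next
  case (insert c0 L)
  obtain \<beta> where \<beta>: "\<forall>i\<in>I. \<bar>\<beta> i\<bar> < \<epsilon> / 2" "\<forall>c\<in>L. (\<Sum>i\<in>I. c i * \<beta> i) \<noteq> 0"
    using insert.IH[of "\<epsilon> / 2"] insert.prems by auto
  define M where "M = (\<Sum>i\<in>I. \<bar>c0 i\<bar>) + 1"
  have M: "M > 0" "\<And>i. i \<in> I \<Longrightarrow> \<bar>c0 i\<bar> < M"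
  proof -
    have "0 \<le> (\<Sum>i\<in>I. \<bar>c0 i\<bar>)" by (rule sum_nonneg) auto
    then show "M > 0" unfolding M_def by (rule add_nonneg_pos) simp
    show "\<bar>c0 i\<bar> < M" if "i \<in> I" for i
      using member_le_sum[OF that, of "\<lambda>i. \<bar>c0 i\<bar>"] assms(1) by (simp add: M_def)
  qed
  let ?p = "\<lambda>c. \<Sum>i\<in>I. c i * c0 i" and ?q = "\<lambda>c. \<Sum>i\<in>I. c i * \<beta> i"
  define B where "B = (\<lambda>c. - ?q c / ?p c) ` insert c0 L"
  have "finite B" using insert.hyps by (simp add: B_def)
  then have "infinite ({0<..<\<epsilon> / (2 * M)} - B)"
    using insert.prems M(1) by (simp add: Diff_infinite_finite)
  then obtain t where "t \<in> {0<..<\<epsilon> / (2 * M)} - B"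
    using infinite_imp_nonempty by blast
  then have t: "0 < t" "t < \<epsilon> / (2 * M)" "t \<notin> B"
    by auto
  have lin: "(\<Sum>i\<in>I. c i * (\<beta> i + t * c0 i)) = ?q c + t * ?p c" for c
    by (simp add: algebra_simps sum.distrib sum_distrib_left)
  have pos: "?p c0 \<noteq> 0"
  proof -
    obtain i where i: "i \<in> I" "c0 i \<noteq> 0" using insert.prems by blast
    have "0 < c0 i * c0 i" using i by (simp add: zero_less_mult_iff) linarith
    also have "\<dots> \<le> ?p c0" by (rule member_le_sum) (use i assms(1) in auto)
    finally show ?thesis by simp
  qed
  have "?q c + t * ?p c \<noteq> 0" if "c \<in> insert c0 L" for c
  proof (cases "?p c = 0")
    case True
    then show ?thesis using that \<beta>(2) pos by auto
  next
    case False
    have "t \<noteq> - ?q c / ?p c" using t(3) that unfolding B_def by blast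
    then show ?thesis using False by (simp add: field_simps eq_neg_iff_add_eq_0)
  qed
  moreover have "\<bar>\<beta> i + t * c0 i\<bar> < \<epsilon>" if "i \<in> I" for i
  proof -
    have "t * \<bar>c0 i\<bar> \<le> t * M" using M(2)[OF that] t(1) by (intro mult_left_mono) auto
    also have "\<dots> < \<epsilon> / 2" using t(2) M(1) by (simp add: field_simps)
    finally have "\<bar>t * c0 i\<bar> < \<epsilon> / 2" using t(1) by (simp add: abs_mult)
    then show ?thesis using \<beta>(1) that by fastforce
  qed
  ultimately show ?case
    by (intro exI[of _ "\<lambda>i. \<beta> i + t * c0 i"]) (simp only: lin, simp)
qed

definition orbit :: "('a \<Rightarrow> 'a) \<Rightarrow> ('a \<Rightarrow> 'a) \<Rightarrow> 'a \<Rightarrow> int \<Rightarrow> 'a" where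
  "orbit T S x k = (if 0 \<le> k then (T ^^ nat k) x else (S ^^ nat (- k)) x)"

lemma funpow_inverse_funpow:
  assumes T: "\<And>x. x \<in> A \<Longrightarrow> T x \<in> A" and ST: "\<And>x. x \<in> A \<Longrightarrow> S (T x) = x"
    and x: "x \<in> A"
  shows "(S ^^ k) ((T ^^ j) x) = orbit T S x (int j - int k)"
proof (induction k arbitrary: j)
  case 0
  then show ?case by (simp add: orbit_def)
next
  case (Suc k)
  have TA: "(T ^^ j) x \<in> A" for j using T x by (induction j) auto
  show ?case
  proof (cases j)
    case 0
    then show ?thesis by (simp add: orbit_def nat_minus_as_int nat_add_distrib)
  next
    case (Suc i)
    have "(S ^^ Suc k) ((T ^^ j) x) = (S ^^ k) (S (T ((T ^^ i) x)))"
      by (simp add: Suc funpow_swap1)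
    then show ?thesis using Suc.IH[of i] ST[OF TA] Suc by simp
  qed
qed

text \<open>The transition intervals of distinct ramps are disjoint, so at any time at most one of
  the \<open>n * N\<close> ramps used below takes a value strictly between 0 and 1. This is what bounds the
  number of impure pairs \<open>(s, j)\<close>.\<close>

definition ramp :: "nat \<Rightarrow> real \<Rightarrow> real" where
  "ramp m t = max 0 (min 1 (t - real m))"

lemma ramp_pure: "\<not> (real m < t \<and> t < real m + 1) \<Longrightarrow> ramp m t \<in> {0, 1}"
  by (auto simp: ramp_def)

lemma ramp_bounds: "0 \<le> ramp m t" "ramp m t \<le> 1"
  by (auto simp: ramp_def)

lemma card_impure_le:
  fixes w :: "int \<Rightarrow> real"
  assumes N: "N > 0"
  shows "card {(s, j). s < n \<and> j < N \<and> (\<exists>k<N. ramp (s * N + k) (w (int j - int k)) \<notin> {0, 1})} \<le> 2 * N"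
proof -
  define f where "f l = (nat \<lfloor>w l\<rfloor> div N, nat (l + int (nat \<lfloor>w l\<rfloor> mod N)))" for l
  have "{(s, j). s < n \<and> j < N \<and> (\<exists>k<N. ramp (s * N + k) (w (int j - int k)) \<notin> {0, 1})}
      \<subseteq> f ` {- int N..<int N}"
  proof (rule subsetI)
    fix z assume "z \<in> {(s, j). s < n \<and> j < N \<and> (\<exists>k<N. ramp (s * N + k) (w (int j - int k)) \<notin> {0, 1})}"
    then obtain s j k where z: "z = (s, j)"
      and a: "s < n" "j < N" "k < N" "ramp (s * N + k) (w (int j - int k)) \<notin> {0, 1}"
      by blast
    then have "real (s * N + k) < w (int j - int k)" "w (int j - int k) < real (s * N + k) + 1"
      using ramp_pure[of "s * N + k"] by blast+
    then have "\<lfloor>w (int j - int k)\<rfloor> = int (s * N + k)" by linarith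
    then have "nat \<lfloor>w (int j - int k)\<rfloor> = s * N + k" by (metis nat_int)
    then have f: "f (int j - int k) = (s, j)"
      using a(3) by (simp add: f_def)
    have "int j - int k \<in> {- int N..<int N}" using a by auto
    then show "z \<in> f ` {- int N..<int N}"
      unfolding z f[symmetric] by (rule imageI)
  qed
  then have "card {(s, j). s < n \<and> j < N \<and> (\<exists>k<N. ramp (s * N + k) (w (int j - int k)) \<notin> {0, 1})}
      \<le> card (f ` {- int N..<int N})"
    by (intro card_mono) auto
  also have "\<dots> \<le> card {- int N..<int N}" by (rule card_image_le) auto
  finally show ?thesis by simp
qed

lemma compactin_finite_subcover:
  assumes "compactin X K" "\<And>i. i \<in> I \<Longrightarrow> openin X (G i)" "K \<subseteq> \<Union>(G ` I)"
  shows "\<exists>F. finite F \<and> F \<subseteq> I \<and> K \<subseteq> \<Union>(G ` F)"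
proof -
  have "(\<forall>U\<in>G ` I. openin X U) \<and> K \<subseteq> \<Union>(G ` I)" using assms by blast
  then have "\<exists>\<F>. finite \<F> \<and> \<F> \<subseteq> G ` I \<and> K \<subseteq> \<Union>\<F>"
    by (rule assms(1)[unfolded compactin_def, THEN conjunct2, rule_format])
  then obtain \<F> where \<F>: "finite \<F>" "\<F> \<subseteq> G ` I" "K \<subseteq> \<Union>\<F>" by (elim exE conjE)
  obtain F where "F \<subseteq> I" "finite F" "\<F> = G ` F"
    using finite_subset_image[OF \<F>(1,2)] by (elim exE conjE)
  with \<F>(3) show ?thesis by blast
qed

lemma continuous_map_funpow: "continuous_map X X f \<Longrightarrow> continuous_map X X (f ^^ k)"
proof (induction k)
  case (Suc k)
  then show ?case using continuous_map_compose[of X X "f ^^ k" X f] by (simp only: funpow.simps)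
qed (simp add: id_def)

lemma Cov_small_oscillation:
  fixes g :: "nat \<Rightarrow> 'a \<Rightarrow> real"
  assumes X: "compact_space X" and g: "\<And>s. s < n \<Longrightarrow> continuous_map X euclideanreal (g s)" and \<epsilon>: "\<epsilon> > 0"
  shows "\<exists>\<U>\<in>Cov X. \<forall>u\<in>\<U>. \<exists>p\<in>topspace X. \<forall>x\<in>u. \<forall>s<n. \<bar>g s x - g s p\<bar> < \<epsilon>"
proof -
  let ?B = "\<lambda>p. topspace X \<inter> (\<Inter>s\<in>{..<n}. {x \<in> topspace X. g s x \<in> ball (g s p) \<epsilon>})"
  have "openin X (?B p)" for p
  proof (cases "n = 0")
    case False
    then have "openin X (\<Inter>s\<in>{..<n}. {x \<in> topspace X. g s x \<in> ball (g s p) \<epsilon>})"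
      by (intro openin_Inter) (auto intro!: openin_continuous_map_preimage[OF g] simp del: mem_ball)
    then show ?thesis by (intro openin_Int) auto
  qed auto
  moreover have "topspace X \<subseteq> \<Union>(?B ` topspace X)" using \<epsilon> by auto
  ultimately obtain \<F> where \<F>: "finite \<F>" "\<F> \<subseteq> ?B ` topspace X" "topspace X \<subseteq> \<Union>\<F>"
    using X[unfolded compact_space_alt, rule_format, of "?B ` topspace X"] by auto
  have "\<F> \<in> Cov X"
    unfolding Cov_def using \<F> \<open>\<And>p. openin X (?B p)\<close> by (auto simp del: mem_ball)
  moreover have "\<exists>p\<in>topspace X. \<forall>x\<in>u. \<forall>s<n. \<bar>g s x - g s p\<bar> < \<epsilon>" if u: "u \<in> \<F>" for u
  proof -
    obtain p where "p \<in> topspace X" "u = ?B p" using \<F>(2) u by blast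
    then show ?thesis by (intro bexI[of _ p]) (auto simp: dist_real_def abs_minus_commute)
  qed
  ultimately show ?thesis by blast
qed

lemma perturbation_coefficients:
  fixes a :: "'v \<Rightarrow> nat \<Rightarrow> real" and n N :: nat
  assumes "finite V" "\<epsilon> > 0"
  shows "\<exists>\<beta>. (\<forall>s<n. \<forall>k<N. \<bar>\<beta> (s, k)\<bar> < \<epsilon>) \<and>
    (\<forall>W S \<delta> j. W \<subseteq> V \<longrightarrow> S \<subseteq> {..<n} \<longrightarrow> card W < card S \<longrightarrow> j < N \<longrightarrow>
       (\<forall>s\<in>S. \<forall>k<N. \<delta> s k \<in> {-1, 0, 1}) \<longrightarrow> (\<forall>s\<in>S. \<delta> s j \<noteq> 0) \<longrightarrow>
       (\<exists>\<alpha>. (\<forall>v\<in>W. (\<Sum>s\<in>S. \<alpha> s * a v s) = 0) \<and> (\<Sum>s\<in>S. \<alpha> s * (\<Sum>k<N. \<beta> (s, k) * \<delta> s k)) \<noteq> (0::real)))"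
proof -
  define \<alpha> where "\<alpha> W S = (SOME \<alpha>. (\<exists>s\<in>S. \<alpha> s \<noteq> (0::real)) \<and> (\<forall>v\<in>W. (\<Sum>s\<in>S. \<alpha> s * a v s) = 0))" for W S
  have \<alpha>: "(\<exists>s\<in>S. \<alpha> W S s \<noteq> 0) \<and> (\<forall>v\<in>W. (\<Sum>s\<in>S. \<alpha> W S s * a v s) = 0)"
    if "W \<subseteq> V" "S \<subseteq> {..<n}" "card W < card S" for W S
  proof -
    have "finite W" "finite S" using that assms(1) by (auto intro: finite_subset)
    from someI_ex[OF exists_orthogonal_vector[OF this that(3), of a]] show ?thesis
      unfolding \<alpha>_def .
  qed
  let ?I = "{..<n} \<times> {..<N}"
  let ?D = "PiE ?I (\<lambda>_. {-1, 0, 1::real})"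
  let ?c = "\<lambda>(W, S, d). \<lambda>(s, k). if s \<in> S then \<alpha> W S s * d (s, k) else 0"
  let ?L = "?c ` (Pow V \<times> Pow {..<n} \<times> ?D)"
  have "finite (?L \<inter> {c. \<exists>i\<in>?I. c i \<noteq> 0})"
    using assms(1) by (intro finite_Int disjI1 finite_imageI finite_cartesian_product finite_PiE) auto
  then obtain \<beta> where \<beta>: "\<forall>i\<in>?I. \<bar>\<beta> i\<bar> < \<epsilon>"
    "\<forall>c\<in>?L \<inter> {c. \<exists>i\<in>?I. c i \<noteq> 0}. (\<Sum>i\<in>?I. c i * \<beta> i) \<noteq> 0"
    using small_vector_off_hyperplanes[of ?I "?L \<inter> {c. \<exists>i\<in>?I. c i \<noteq> 0}" \<epsilon>] assms(2) by auto
  show ?thesis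
  proof (intro exI[of _ \<beta>] conjI allI impI)
    show "\<bar>\<beta> (s, k)\<bar> < \<epsilon>" if "s < n" "k < N" for s k using \<beta>(1) that by auto
    fix W S \<delta> j
    assume W: "W \<subseteq> V" and S: "S \<subseteq> {..<n}" and card: "card W < card S" and j: "j < N"
      and \<delta>: "\<forall>s\<in>S. \<forall>k<N. \<delta> s k \<in> {-1, 0, 1::real}" and \<delta>j: "\<forall>s\<in>S. \<delta> s j \<noteq> 0"
    define d where "d = restrict (\<lambda>(s, k). if s \<in> S then \<delta> s k else 0) ?I"
    let ?e = "?c (W, S, d)"
    have "d \<in> ?D"
      using \<delta> unfolding d_def by (intro restrict_PiE_iff[THEN iffD2]) auto
    then have "(W, S, d) \<in> Pow V \<times> Pow {..<n} \<times> ?D" using W S by simp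
    then have "?e \<in> ?L" by (rule imageI)
    moreover have "\<exists>i\<in>?I. ?e i \<noteq> 0"
    proof -
      obtain s where s: "s \<in> S" "\<alpha> W S s \<noteq> 0" using \<alpha>[OF W S card] by blast
      then show ?thesis
        using S j \<delta>j by (intro bexI[of _ "(s, j)"]) (auto simp: d_def)
    qed
    ultimately have "(\<Sum>i\<in>?I. ?e i * \<beta> i) \<noteq> 0" using \<beta>(2) by blast
    moreover have "(\<Sum>i\<in>?I. ?e i * \<beta> i) = (\<Sum>s\<in>S. \<alpha> W S s * (\<Sum>k<N. \<beta> (s, k) * \<delta> s k))"
    proof -
      have "(\<Sum>i\<in>?I. ?e i * \<beta> i) = (\<Sum>s<n. \<Sum>k<N. ?e (s, k) * \<beta> (s, k))"
        by (rule sum.cartesian_product')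
      also have "\<dots> = (\<Sum>s<n. if s \<in> S then \<alpha> W S s * (\<Sum>k<N. \<beta> (s, k) * \<delta> s k) else 0)"
        by (intro sum.cong) (auto simp: d_def sum_distrib_left mult_ac intro!: sum.cong)
      also have "\<dots> = (\<Sum>s\<in>S. \<alpha> W S s * (\<Sum>k<N. \<beta> (s, k) * \<delta> s k))"
        using S by (simp add: sum.If_cases Int_absorb1)
      finally show ?thesis .
    qed
    ultimately show "\<exists>\<alpha>. (\<forall>v\<in>W. (\<Sum>s\<in>S. \<alpha> s * a v s) = 0) \<and>
        (\<Sum>s\<in>S. \<alpha> s * (\<Sum>k<N. \<beta> (s, k) * \<delta> s k)) \<noteq> 0"
      using \<alpha>[OF W S card] by (intro exI[of _ "\<alpha> W S"]) simp
  qed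
qed

text \<open>The bound on the mean order leaves, at some time \<open>j\<close>, more pure coordinates than active
  members of the partition of unity. There a linear relation with generic coefficients fails.\<close>

lemma exists_good_time:
  fixes P Q :: "nat \<Rightarrow> nat \<Rightarrow> bool" and c d :: "nat \<Rightarrow> nat"
  assumes N: "N > 0" and n: "n = 2 * D + 7"
    and P: "card {(s, j). s < n \<and> j < N \<and> \<not> P s j} \<le> 2 * N"
    and Q: "card {(s, j). s < n \<and> j < N \<and> \<not> Q s j} \<le> 2 * N"
    and c: "(\<Sum>j<N. c j) \<le> (D + 1) * N" and d: "(\<Sum>j<N. d j) \<le> (D + 1) * N"
  shows "\<exists>j<N. c j + d j < card {s. s < n \<and> P s j \<and> Q s j}"
proof (rule ccontr)
  have count: "card {(s, j). s < n \<and> j < N \<and> R s j} = (\<Sum>j<N. card {s. s < n \<and> R s j})" for R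
  proof -
    have "{(s, j). s < n \<and> j < N \<and> R s j} = prod.swap ` (SIGMA j:{..<N}. {s. s < n \<and> R s j})"
      by force
    then show ?thesis by (simp add: card_image card_SigmaI)
  qed
  assume contra: "\<not> ?thesis"
  have "n \<le> (c j + d j) + card {s. s < n \<and> \<not> P s j} + card {s. s < n \<and> \<not> Q s j}" if "j < N" for j
  proof -
    have "n = card ({s. s < n \<and> P s j \<and> Q s j} \<union> {s. s < n \<and> \<not> P s j} \<union> {s. s < n \<and> \<not> Q s j})"
      by (subst card_lessThan[symmetric]) (rule arg_cong[where f=card], auto)
    also have "\<dots> \<le> card {s. s < n \<and> P s j \<and> Q s j} + card {s. s < n \<and> \<not> P s j} + card {s. s < n \<and> \<not> Q s j}"
      by (meson add_le_mono1 card_Un_le le_trans)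
    finally show ?thesis using contra that by fastforce
  qed
  then have "(\<Sum>j<N. n) \<le> (\<Sum>j<N. (c j + d j) + card {s. s < n \<and> \<not> P s j} + card {s. s < n \<and> \<not> Q s j})"
    by (intro sum_mono) auto
  also have "\<dots> = (\<Sum>j<N. c j) + (\<Sum>j<N. d j) + card {(s, j). s < n \<and> j < N \<and> \<not> P s j}
      + card {(s, j). s < n \<and> j < N \<and> \<not> Q s j}"
    by (simp add: sum.distrib count)
  also have "\<dots> \<le> (D + 1) * N + (D + 1) * N + 2 * N + 2 * N"
    using P Q c d by linarith
  finally have "N * (2 * D + 7) \<le> N * (2 * D + 6)" by (simp add: n algebra_simps)
  then show False using N by simp
qed

lemma perturb_to_separate:
  fixes g :: "nat \<Rightarrow> 'a \<Rightarrow> real" and u :: "'a \<Rightarrow> real"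
  assumes X: "top_dyn_system X T" and D: "dyn_dim X T < of_nat D" and n: "n = 2 * D + 7"
    and g: "\<And>s. s < n \<Longrightarrow> continuous_map X euclideanreal (g s)" and \<eta>: "\<eta> > 0"
    and u: "continuous_map X euclideanreal u"
  shows "\<exists>g'. (\<forall>s<n. continuous_map X euclideanreal (g' s)) \<and>
    (\<forall>s<n. \<forall>x\<in>topspace X. \<bar>g' s x - g s x\<bar> < \<eta>) \<and>
    (\<forall>x\<in>topspace X. \<forall>y\<in>topspace X. u x \<le> 0 \<longrightarrow> 1 \<le> u y \<longrightarrow>
      (\<exists>s<n. \<exists>j. g' s ((T ^^ j) x) \<noteq> g' s ((T ^^ j) y)))"
proof -
  have compact: "compact_space X" and hom: "homeomorphic_map X X T"
    using X by (auto simp: top_dyn_system_def)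
  obtain S where S: "homeomorphic_maps X X T S"
    using hom homeomorphic_map_maps by blast
  have contT: "continuous_map X X T" and contS: "continuous_map X X S"
    and ST: "\<And>x. x \<in> topspace X \<Longrightarrow> S (T x) = x"
    using S by (auto simp: homeomorphic_maps_def)
  have TX: "\<And>x. x \<in> topspace X \<Longrightarrow> T x \<in> topspace X"
    using contT continuous_map_image_subset_topspace by blast
  note contSk = continuous_map_funpow[OF contS]
  have TjX: "(T ^^ j) x \<in> topspace X" if "x \<in> topspace X" for j x
    using top_dyn_system_funpow[OF X that] .
  obtain \<U> where \<U>: "\<U> \<in> Cov X" "\<forall>u\<in>\<U>. \<exists>p\<in>topspace X. \<forall>x\<in>u. \<forall>s<n. \<bar>g s x - g s p\<bar> < \<eta> / 2"
    using Cov_small_oscillation[of X n g "\<eta> / 2", OF compact g] \<eta> by auto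
  obtain V :: "'a set set" and \<phi> N where "finite V \<and> N > 0 \<and>
    (\<forall>v\<in>V. continuous_map X euclideanreal (\<phi> v)) \<and>
    (\<forall>v\<in>V. \<forall>x\<in>topspace X. 0 \<le> \<phi> v x) \<and>
    (\<forall>x\<in>topspace X. (\<Sum>v\<in>V. \<phi> v x) = 1) \<and>
    (\<forall>v\<in>V. \<exists>u\<in>\<U>. \<forall>x\<in>topspace X. \<phi> v x \<noteq> 0 \<longrightarrow> x \<in> u) \<and>
    (\<forall>x\<in>topspace X. (\<Sum>j<N. card {v\<in>V. \<phi> v ((T ^^ j) x) \<noteq> 0}) \<le> (D + 1) * N)"
    using partition_of_unity_mean_order[OF X D \<U>(1)] by (elim exE)
  then have V: "finite V" and N: "N > 0"
    and \<phi>: "\<And>v. v \<in> V \<Longrightarrow> continuous_map X euclideanreal (\<phi> v)"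
      "\<And>v x. v \<in> V \<Longrightarrow> x \<in> topspace X \<Longrightarrow> 0 \<le> \<phi> v x"
      "\<And>x. x \<in> topspace X \<Longrightarrow> (\<Sum>v\<in>V. \<phi> v x) = 1"
      "\<And>v. v \<in> V \<Longrightarrow> \<exists>u\<in>\<U>. \<forall>x\<in>topspace X. \<phi> v x \<noteq> 0 \<longrightarrow> x \<in> u"
      "\<And>x. x \<in> topspace X \<Longrightarrow> (\<Sum>j<N. card {v\<in>V. \<phi> v ((T ^^ j) x) \<noteq> 0}) \<le> (D + 1) * N"
    by simp_all
  have "\<forall>v. \<exists>p. v \<in> V \<longrightarrow> (\<forall>x\<in>topspace X. \<phi> v x \<noteq> 0 \<longrightarrow> (\<forall>s<n. \<bar>g s x - g s p\<bar> < \<eta> / 2))"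
  proof
    fix v
    show "\<exists>p. v \<in> V \<longrightarrow> (\<forall>x\<in>topspace X. \<phi> v x \<noteq> 0 \<longrightarrow> (\<forall>s<n. \<bar>g s x - g s p\<bar> < \<eta> / 2))"
    proof (cases "v \<in> V")
      case True
      then obtain w where w: "w \<in> \<U>" "\<forall>x\<in>topspace X. \<phi> v x \<noteq> 0 \<longrightarrow> x \<in> w" using \<phi>(4) by blast
      obtain p where "\<forall>x\<in>w. \<forall>s<n. \<bar>g s x - g s p\<bar> < \<eta> / 2" using \<U>(2) w(1) by blast
      then show ?thesis using w(2) by (intro exI[of _ p]) simp
    qed simp
  qed
  then obtain p where p: "\<forall>v. v \<in> V \<longrightarrow> (\<forall>x\<in>topspace X. \<phi> v x \<noteq> 0 \<longrightarrow> (\<forall>s<n. \<bar>g s x - g s (p v)\<bar> < \<eta> / 2))"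
    unfolding choice_iff by (elim exE)
  define a where "a v s = g s (p v)" for v s
  define M where "M = real (n * N)"
  define r where "r s k z = ramp (s * N + k) (M * u ((S ^^ k) z))" for s k z
  have r_orbit: "r s k ((T ^^ j) x) = ramp (s * N + k) (M * u (orbit T S x (int j - int k)))"
    if "x \<in> topspace X" for s k j x
    unfolding r_def by (simp add: funpow_inverse_funpow[where A="topspace X", OF TX ST that])
  have r_cont: "continuous_map X euclideanreal (r s k)" for s k
  proof -
    have "continuous_map X euclideanreal (u \<circ> (S ^^ k))"
      by (rule continuous_map_compose[OF contSk u])
    then show ?thesis
      unfolding r_def ramp_def o_def
      by (intro continuous_map_real_max continuous_map_real_min continuous_map_diff
          continuous_map_real_mult) auto
  qed
  have r_bounds: "0 \<le> r s k z" "r s k z \<le> 1" for s k z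
    by (simp_all add: r_def ramp_bounds)
  have "0 < \<eta> / (2 * real N)" using \<eta> N by simp
  from perturbation_coefficients[OF V this, of n N a]
  obtain \<beta> where \<beta>: "\<forall>s<n. \<forall>k<N. \<bar>\<beta> (s, k)\<bar> < \<eta> / (2 * real N)"
    "\<forall>W S \<delta> j. W \<subseteq> V \<longrightarrow> S \<subseteq> {..<n} \<longrightarrow> card W < card S \<longrightarrow> j < N \<longrightarrow>
       (\<forall>s\<in>S. \<forall>k<N. \<delta> s k \<in> {-1, 0, 1}) \<longrightarrow> (\<forall>s\<in>S. \<delta> s j \<noteq> 0) \<longrightarrow>
       (\<exists>\<alpha>. (\<forall>v\<in>W. (\<Sum>s\<in>S. \<alpha> s * a v s) = 0) \<and> (\<Sum>s\<in>S. \<alpha> s * (\<Sum>k<N. \<beta> (s, k) * \<delta> s k)) \<noteq> (0::real))"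
    by (elim exE conjE)
  define g' where "g' s z = (\<Sum>v\<in>V. \<phi> v z * a v s) + (\<Sum>k<N. \<beta> (s, k) * r s k z)" for s z
  have "continuous_map X euclideanreal (g' s)" for s
    unfolding g'_def using \<phi>(1) r_cont V
    by (intro continuous_map_add continuous_map_sum continuous_map_real_mult) auto
  moreover have "\<bar>g' s x - g s x\<bar> < \<eta>" if s: "s < n" and x: "x \<in> topspace X" for s x
  proof -
    have "(\<Sum>v\<in>V. \<phi> v x * a v s) - g s x = (\<Sum>v\<in>V. \<phi> v x * (a v s - g s x))"
      using \<phi>(3)[OF x] by (simp add: right_diff_distrib sum_subtractf flip: sum_distrib_right)
    also have "\<bar>\<dots>\<bar> \<le> (\<Sum>v\<in>V. \<phi> v x * (\<eta> / 2))"
    proof (rule order_trans[OF sum_abs sum_mono])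
      fix v assume v: "v \<in> V"
      show "\<bar>\<phi> v x * (a v s - g s x)\<bar> \<le> \<phi> v x * (\<eta> / 2)"
      proof (cases "\<phi> v x = 0")
        case False
        then have "\<bar>a v s - g s x\<bar> < \<eta> / 2"
          using p v x s by (simp add: a_def abs_minus_commute)
        then show ?thesis
          using \<phi>(2)[OF v x] unfolding abs_mult by (intro mult_mono) auto
      qed simp
    qed
    also have "\<dots> = \<eta> / 2" using \<phi>(3)[OF x] by (metis mult_1 sum_distrib_right)
    finally have 1: "\<bar>(\<Sum>v\<in>V. \<phi> v x * a v s) - g s x\<bar> \<le> \<eta> / 2" .
    have "\<bar>\<Sum>k<N. \<beta> (s, k) * r s k x\<bar> \<le> (\<Sum>k<N. \<bar>\<beta> (s, k) * r s k x\<bar>)" by (rule sum_abs)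
    also have "\<dots> < (\<Sum>k<N. \<eta> / (2 * real N))"
    proof (rule sum_strict_mono)
      fix k assume "k \<in> {..<N}"
      then have b: "\<bar>\<beta> (s, k)\<bar> < \<eta> / (2 * real N)" using \<beta>(1) s by simp
      have "\<bar>\<beta> (s, k) * r s k x\<bar> \<le> \<bar>\<beta> (s, k)\<bar> * 1"
        using r_bounds[of s k x] unfolding abs_mult by (intro mult_left_mono) auto
      then show "\<bar>\<beta> (s, k) * r s k x\<bar> < \<eta> / (2 * real N)" using b by linarith
    qed (use N in auto)
    also have "\<dots> = \<eta> / 2" using N by simp
    finally show ?thesis using 1 unfolding g'_def by linarith
  qed
  moreover have "\<exists>s<n. \<exists>j. g' s ((T ^^ j) x) \<noteq> g' s ((T ^^ j) y)"
    if x: "x \<in> topspace X" and y: "y \<in> topspace X" and ux: "u x \<le> 0" and uy: "1 \<le> u y" for x y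
  proof (rule ccontr)
    assume "\<not> ?thesis"
    then have eq: "g' s ((T ^^ j) x) = g' s ((T ^^ j) y)" if "s < n" for s j using that by blast
    let ?P = "\<lambda>z s j. \<forall>k<N. r s k ((T ^^ j) z) \<in> {0, 1}"
    have impure: "card {(s, j). s < n \<and> j < N \<and> \<not> ?P z s j} \<le> 2 * N" if z: "z \<in> topspace X" for z
      using card_impure_le[OF N, of n "\<lambda>l. M * u (orbit T S z l)"]
      by (simp add: r_orbit[OF z])
    obtain j where j: "j < N" and card_j: "card {v\<in>V. \<phi> v ((T ^^ j) x) \<noteq> 0} + card {v\<in>V. \<phi> v ((T ^^ j) y) \<noteq> 0}
        < card {s. s < n \<and> ?P x s j \<and> ?P y s j}"
      using exists_good_time[OF N n impure[OF x] impure[OF y] \<phi>(5)[OF x] \<phi>(5)[OF y]] by (elim exE conjE)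
    let ?x = "(T ^^ j) x" and ?y = "(T ^^ j) y"
    define I where "I = {s. s < n \<and> ?P x s j \<and> ?P y s j}"
    define W where "W = {v\<in>V. \<phi> v ?x \<noteq> 0} \<union> {v\<in>V. \<phi> v ?y \<noteq> 0}"
    have card_W: "card W < card I"
      using card_j card_Un_le[of "{v\<in>V. \<phi> v ?x \<noteq> 0}" "{v\<in>V. \<phi> v ?y \<noteq> 0}"]
      unfolding I_def W_def by linarith
    have I: "I \<subseteq> {..<n}" and W: "W \<subseteq> V" by (auto simp: I_def W_def)
    have pure: "r s k ?x \<in> {0, 1} \<and> r s k ?y \<in> {0, 1}" if "s \<in> I" "k < N" for s k
      using that unfolding I_def by blast
    have range: "\<forall>s\<in>I. \<forall>k<N. r s k ?x - r s k ?y \<in> {-1, 0, 1}"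
      using pure by fastforce
    have differ: "r s j ?x - r s j ?y \<noteq> 0" if s: "s < n" for s
    proof -
      have "M * u x \<le> 0" using ux by (simp add: M_def mult_nonneg_nonpos)
      then have "M * u x - real (s * N + j) \<le> 0"
        using of_nat_0_le_iff[of "s * N + j", where 'a=real] by linarith
      then have "ramp (s * N + j) (M * u x) = 0" unfolding ramp_def by linarith
      then have "r s j ?x = 0"
        using r_orbit[OF x, of s j j] by (simp add: orbit_def)
      moreover have "r s j ?y = 1"
      proof -
        have "s * N + j + 1 \<le> n * N"
        proof -
          have "s * N + j + 1 \<le> Suc s * N" using j by simp
          also have "\<dots> \<le> n * N" using s by (intro mult_right_mono) auto
          finally show ?thesis .
        qed
        then have "real (s * N + j) + 1 \<le> M" unfolding M_def by linarith
        also have "M \<le> M * u y" using uy mult_left_mono[of 1 "u y" M] by (simp add: M_def)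
        finally have "ramp (s * N + j) (M * u y) = 1" unfolding ramp_def by linarith
        then show ?thesis
          using r_orbit[OF y, of s j j] by (simp add: orbit_def)
      qed
      ultimately show ?thesis by simp
    qed
    obtain \<alpha> where \<alpha>: "\<forall>v\<in>W. (\<Sum>s\<in>I. \<alpha> s * a v s) = 0"
      "(\<Sum>s\<in>I. \<alpha> s * (\<Sum>k<N. \<beta> (s, k) * (r s k ?x - r s k ?y))) \<noteq> 0"
      using \<beta>(2)[rule_format, OF W I card_W j, of "\<lambda>s k. r s k ?x - r s k ?y"] range differ I
      by (auto simp: I_def)
    have vanish: "(\<Sum>s\<in>I. \<alpha> s * (\<Sum>v\<in>V. \<phi> v z * a v s)) = 0" if z: "{v\<in>V. \<phi> v z \<noteq> 0} \<subseteq> W" for z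
    proof -
      have "(\<Sum>s\<in>I. \<alpha> s * (\<Sum>v\<in>V. \<phi> v z * a v s)) = (\<Sum>v\<in>V. \<phi> v z * (\<Sum>s\<in>I. \<alpha> s * a v s))"
        unfolding sum_distrib_left by (subst sum.swap) (simp add: mult_ac)
      also have "\<dots> = 0"
      proof (rule sum.neutral, rule ballI)
        fix v assume "v \<in> V"
        then show "\<phi> v z * (\<Sum>s\<in>I. \<alpha> s * a v s) = 0" using z \<alpha>(1) by (cases "\<phi> v z = 0") auto
      qed
      finally show ?thesis .
    qed
    have "(\<Sum>s\<in>I. \<alpha> s * g' s ?x) = (\<Sum>s\<in>I. \<alpha> s * g' s ?y)"
      using eq I by (intro sum.cong) auto
    then have "(\<Sum>s\<in>I. \<alpha> s * (\<Sum>k<N. \<beta> (s, k) * r s k ?x)) = (\<Sum>s\<in>I. \<alpha> s * (\<Sum>k<N. \<beta> (s, k) * r s k ?y))"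
      using vanish[of ?x] vanish[of ?y] by (simp add: g'_def distrib_left sum.distrib W_def)
    then show False
      using \<alpha>(2) by (simp add: right_diff_distrib sum_subtractf)
  qed
  ultimately show ?thesis by blast
qed

section \<open>Construction of the embedding\<close>

lemma compact_metrizable_separating_functions:
  assumes X: "compact_space X" "metrizable_space X"
  shows "\<exists>u :: nat \<Rightarrow> 'a \<Rightarrow> real. (\<forall>i. continuous_map X euclideanreal (u i)) \<and>
    (\<forall>x\<in>topspace X. \<forall>y\<in>topspace X. x \<noteq> y \<longrightarrow> (\<exists>i. u i x \<le> 0 \<and> 1 \<le> u i y))"
proof -
  obtain M d where "Metric_space M d" and XM: "X = Metric_space.mtopology M d"
    using X(2) unfolding metrizable_space_def by blast
  interpret Metric_space M d by fact
  have top: "topspace X = M" by (simp add: XM)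
  have "mtotally_bounded M"
    using X(1) compactin_imp_mtotally_bounded[of M] by (simp add: XM compact_space_def)
  then have "\<forall>m. \<exists>K. finite K \<and> K \<subseteq> M \<and> M \<subseteq> (\<Union>x\<in>K. mball x (1 / real (Suc m)))"
    unfolding mtotally_bounded_def by simp
  then obtain K where K: "\<forall>m. finite (K m) \<and> K m \<subseteq> M \<and> M \<subseteq> (\<Union>x\<in>K m. mball x (1 / real (Suc m)))"
    unfolding choice_iff by (elim exE)
  define f where "f = (\<lambda>(m, c) x. d c x * real (Suc m) - 1)"
  define I where "I = (SIGMA m:UNIV. K m)"
  have sep: "\<exists>p\<in>I. f p x \<le> 0 \<and> 1 \<le> f p y" if x: "x \<in> M" and y: "y \<in> M" and ne: "x \<noteq> y" for x y
  proof -
    have "0 < d x y / 3" using x y ne by simp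
    then obtain m where m: "1 / real (Suc m) < d x y / 3" using nat_approx_posE by blast
    obtain c where c: "c \<in> K m" "c \<in> M" "d c x < 1 / real (Suc m)" using K x by fastforce
    have "d x y \<le> d c x + d c y" using triangle[of x c y] x y c commute by simp
    then have "2 / real (Suc m) \<le> d c y" using c(3) m by simp
    then have "2 \<le> d c y * real (Suc m)" by (simp add: pos_divide_le_eq del: of_nat_Suc)
    moreover have "d c x * real (Suc m) \<le> 1" using c(3) by (simp add: pos_less_divide_eq del: of_nat_Suc)
    ultimately show ?thesis
      using c(1) by (intro bexI[of _ "(m, c)"]) (auto simp: f_def I_def)
  qed
  have cont: "continuous_map X euclideanreal (f p)" if p: "p \<in> I" for p
  proof -
    obtain m c where mc: "p = (m, c)" "c \<in> M" using p K unfolding I_def by blast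
    have "continuous_map mtopology euclideanreal (\<lambda>x. d c x)"
      using continuous_map_mdist[of mtopology Self "\<lambda>_. c" "\<lambda>x. x"] mc(2)
      by (simp add: mtopology_of_def)
    then show ?thesis
      unfolding mc f_def XM by (auto intro!: continuous_map_diff continuous_map_real_mult)
  qed
  show ?thesis
  proof (cases "I = {}")
    case True
    then show ?thesis
      using sep top by (intro exI[of _ "\<lambda>_ _. 0"]) auto
  next
    case False
    have "countable I"
      unfolding I_def using K by (intro countable_SIGMA) (auto intro: countable_finite)
    then have "range (from_nat_into I) = I" using False by (rule range_from_nat_into[rotated])
    then show ?thesis
      using cont sep unfolding top by (intro exI[of _ "\<lambda>i. f (from_nat_into I i)"]) (metis rangeE rangeI)
  qed
qed

definition separates_levels ::
  "'a topology \<Rightarrow> ('a \<Rightarrow> 'a) \<Rightarrow> ('a \<Rightarrow> real) \<Rightarrow> nat \<Rightarrow> (nat \<Rightarrow> 'a \<Rightarrow> real) \<Rightarrow> bool" where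
  "separates_levels X T u n g \<longleftrightarrow> (\<forall>x\<in>topspace X. \<forall>y\<in>topspace X. u x \<le> 0 \<longrightarrow> 1 \<le> u y \<longrightarrow>
      (\<exists>s<n. \<exists>j. g s ((T ^^ j) x) \<noteq> g s ((T ^^ j) y)))"

lemma separates_levels_open:
  fixes g :: "nat \<Rightarrow> 'a \<Rightarrow> real"
  assumes X: "top_dyn_system X T" and g: "\<And>s. s < n \<Longrightarrow> continuous_map X euclideanreal (g s)"
    and u: "continuous_map X euclideanreal u" and sep: "separates_levels X T u n g"
  shows "\<exists>\<epsilon>>0. \<forall>h. (\<forall>s<n. \<forall>x\<in>topspace X. \<bar>h s x - g s x\<bar> \<le> \<epsilon>) \<longrightarrow> separates_levels X T u n h"
proof -
  let ?XX = "prod_topology X X"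
  let ?K = "{z \<in> topspace ?XX. u (fst z) \<in> {..0}} \<inter> {z \<in> topspace ?XX. u (snd z) \<in> {1..}}"
  define D where "D s j z = \<bar>g s ((T ^^ j) (fst z)) - g s ((T ^^ j) (snd z))\<bar>" for s j z
  define G where "G = (\<lambda>(s, j, m). {z \<in> topspace ?XX. D s j z \<in> {1 / real (Suc m)<..}})"
  have contT: "continuous_map X X T"
    using X by (auto simp: top_dyn_system_def homeomorphic_imp_continuous_map)
  note contTj = continuous_map_funpow[OF contT]
  have uf: "continuous_map ?XX euclideanreal (\<lambda>z. u (fst z))" "continuous_map ?XX euclideanreal (\<lambda>z. u (snd z))"
    using continuous_map_compose[OF continuous_map_fst u] continuous_map_compose[OF continuous_map_snd u]
    by (simp_all add: o_def)
  have "closedin ?XX ?K"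
    by (intro closedin_Int closedin_continuous_map_preimage[OF uf(1)] closedin_continuous_map_preimage[OF uf(2)]) auto
  then have K: "compactin ?XX ?K"
    using X by (intro closedin_compact_space) (auto simp: top_dyn_system_def compact_space_prod_topology)
  have D_cont: "continuous_map ?XX euclideanreal (D s j)" if "s < n" for s j
  proof -
    have "continuous_map X euclideanreal (g s \<circ> (T ^^ j))"
      by (rule continuous_map_compose[OF contTj g[OF that]])
    from continuous_map_compose[OF continuous_map_fst this] continuous_map_compose[OF continuous_map_snd this]
    show ?thesis
      unfolding D_def by (intro continuous_map_real_abs continuous_map_diff) (simp_all add: o_def)
  qed
  let ?I = "{..<n} \<times> UNIV \<times> UNIV"
  have "openin ?XX (G i)" if "i \<in> ?I" for i
  proof -
    obtain s j m where i: "i = (s, j, m)" "s < n" using \<open>i \<in> ?I\<close> by blast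
    show ?thesis
      unfolding i G_def prod.case by (rule openin_continuous_map_preimage[OF D_cont[OF i(2)]]) auto
  qed
  moreover have "?K \<subseteq> \<Union>(G ` ?I)"
  proof
    fix z assume z: "z \<in> ?K"
    then obtain s j where s: "s < n" "g s ((T ^^ j) (fst z)) \<noteq> g s ((T ^^ j) (snd z))"
      using sep[unfolded separates_levels_def, rule_format, of "fst z" "snd z"] by auto
    then have "0 < D s j z" by (simp add: D_def)
    then obtain m where "1 / real (Suc m) < D s j z" using nat_approx_posE by blast
    then have "z \<in> G (s, j, m)" using z by (simp add: G_def)
    then show "z \<in> \<Union>(G ` ?I)" using s(1) by blast
  qed
  ultimately obtain F where F: "finite F" "F \<subseteq> ?I" "?K \<subseteq> \<Union>(G ` F)"
    using compactin_finite_subcover[OF K, of ?I G] by blast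
  define \<epsilon> where "\<epsilon> = Min (insert 1 ((\<lambda>(s, j, m). 1 / (2 * real (Suc m))) ` F))"
  have "\<epsilon> > 0" unfolding \<epsilon>_def using F(1) by (subst Min_gr_iff) auto
  moreover have "separates_levels X T u n h"
    if h: "\<forall>s<n. \<forall>x\<in>topspace X. \<bar>h s x - g s x\<bar> \<le> \<epsilon>" for h
    unfolding separates_levels_def
  proof (intro ballI impI)
    fix x y assume xy: "x \<in> topspace X" "y \<in> topspace X" "u x \<le> 0" "1 \<le> u y"
    then have "(x, y) \<in> ?K" by simp
    then obtain s j m where i: "(s, j, m) \<in> F" "(x, y) \<in> G (s, j, m)" using F(3) by fast
    have s: "s < n" using i(1) F(2) by blast
    have "\<epsilon> \<le> 1 / (2 * real (Suc m))"
      unfolding \<epsilon>_def using F(1) i(1) by (intro Min_le) force+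
    also have "\<dots> = (1 / real (Suc m)) / 2" by simp
    also have "\<dots> < D s j (x, y) / 2"
    proof (rule divide_strict_right_mono)
      show "1 / real (Suc m) < D s j (x, y)" using i(2) by (simp add: G_def)
    qed simp
    finally have "2 * \<epsilon> < \<bar>g s ((T ^^ j) x) - g s ((T ^^ j) y)\<bar>" by (simp add: D_def)
    moreover have "\<bar>h s ((T ^^ j) x) - g s ((T ^^ j) x)\<bar> \<le> \<epsilon>" "\<bar>h s ((T ^^ j) y) - g s ((T ^^ j) y)\<bar> \<le> \<epsilon>"
      using h s top_dyn_system_funpow[OF X] xy by auto
    ultimately have "h s ((T ^^ j) x) \<noteq> h s ((T ^^ j) y)" by linarith
    then show "\<exists>s<n. \<exists>j. h s ((T ^^ j) x) \<noteq> h s ((T ^^ j) y)" using s by blast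
  qed
  ultimately show ?thesis by blast
qed

lemma exists_separating_functions:
  assumes X: "top_dyn_system X T" and D: "dyn_dim X T < of_nat D" and n: "n = 2 * D + 7"
  shows "\<exists>h :: nat \<Rightarrow> 'a \<Rightarrow> real. (\<forall>s<n. continuous_map X euclideanreal (h s)) \<and>
    (\<forall>x\<in>topspace X. \<forall>y\<in>topspace X. x \<noteq> y \<longrightarrow> (\<exists>s<n. \<exists>j. h s ((T ^^ j) x) \<noteq> h s ((T ^^ j) y)))"
proof -
  have cm: "compact_space X" "metrizable_space X" using X by (simp_all add: top_dyn_system_def)
  obtain u :: "nat \<Rightarrow> 'a \<Rightarrow> real" where u: "\<forall>i. continuous_map X euclideanreal (u i)"
    "\<forall>x\<in>topspace X. \<forall>y\<in>topspace X. x \<noteq> y \<longrightarrow> (\<exists>i. u i x \<le> 0 \<and> 1 \<le> u i y)"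
    using compact_metrizable_separating_functions[OF cm] by (elim exE conjE)
  define close where "close \<epsilon> h g \<longleftrightarrow> (\<forall>s<n. \<forall>x\<in>topspace X. \<bar>h s x - g s x\<bar> \<le> \<epsilon>)"
    for \<epsilon> :: real and h g :: "nat \<Rightarrow> 'a \<Rightarrow> real"
  define P where "P i = (\<lambda>(g, \<epsilon>). (\<forall>s<n. continuous_map X euclideanreal (g s)) \<and> \<epsilon> > 0 \<and>
      (\<forall>h. close \<epsilon> h g \<longrightarrow> separates_levels X T (u i) n h))" for i
  \<comment> \<open>The balls of radius \<open>\<epsilon> i\<close> about \<open>g i\<close> are nested, so the limit separates every level pair.\<close>
  define Q where "Q = (\<lambda>(g, \<epsilon>) (g', \<epsilon>'). close (\<epsilon> / 2) g' g \<and> \<epsilon>' \<le> \<epsilon> / 2)"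
  have step: "\<exists>p. P i p \<and> Q (g, \<epsilon>) p"
    if g: "\<forall>s<n. continuous_map X euclideanreal (g s)" and \<epsilon>: "\<epsilon> > 0" for i g \<epsilon>
  proof -
    have g0: "\<And>s. s < n \<Longrightarrow> continuous_map X euclideanreal (g s)" using g by blast
    have half: "0 < \<epsilon> / 2" using \<epsilon> by simp
    have "\<exists>g'. (\<forall>s<n. continuous_map X euclideanreal (g' s)) \<and>
      (\<forall>s<n. \<forall>x\<in>topspace X. \<bar>g' s x - g s x\<bar> < \<epsilon> / 2) \<and> separates_levels X T (u i) n g'"
      unfolding separates_levels_def
      by (rule perturb_to_separate[OF X D n g0 half u(1)[rule_format]])
    then obtain g' where g': "\<forall>s<n. continuous_map X euclideanreal (g' s)"
      "\<forall>s<n. \<forall>x\<in>topspace X. \<bar>g' s x - g s x\<bar> < \<epsilon> / 2" "separates_levels X T (u i) n g'"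
      by (elim exE conjE)
    have g1: "\<And>s. s < n \<Longrightarrow> continuous_map X euclideanreal (g' s)" using g' by blast
    have "\<exists>\<delta>>0. \<forall>h. close \<delta> h g' \<longrightarrow> separates_levels X T (u i) n h"
      unfolding close_def by (rule separates_levels_open[OF X g1 u(1)[rule_format] g'(3)])
    then obtain \<delta> where \<delta>: "\<delta> > 0" "\<forall>h. close \<delta> h g' \<longrightarrow> separates_levels X T (u i) n h"
      by (elim exE conjE)
    have "close \<delta> h g'" if "close (min \<delta> (\<epsilon> / 2)) h g'" for h
      using that unfolding close_def by fastforce
    then have "P i (g', min \<delta> (\<epsilon> / 2))" using g'(1) \<delta> \<epsilon> by (auto simp: P_def)
    moreover have "Q (g, \<epsilon>) (g', min \<delta> (\<epsilon> / 2))"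
      using g'(2) by (auto simp: Q_def close_def intro: less_imp_le)
    ultimately show ?thesis by blast
  qed
  have "\<exists>f. \<forall>i. P i (f i) \<and> Q (f i) (f (Suc i))"
  proof (rule dependent_nat_choice)
    show "\<exists>p. P 0 p" using step[of "\<lambda>_ _. 0" 1 0] by auto
    show "\<exists>q. P (Suc i) q \<and> Q p q" if "P i p" for p i
      using that step[of "fst p" "snd p" "Suc i"] by (auto simp: P_def case_prod_unfold)
  qed
  then obtain f where f: "\<And>i. P i (f i)" "\<And>i. Q (f i) (f (Suc i))" by blast
  define g where "g i = fst (f i)" for i
  define \<epsilon> where "\<epsilon> i = snd (f i)" for i
  have g_cont: "continuous_map X euclideanreal (g i s)" if "s < n" for i s
    using f(1)[of i] that by (simp add: P_def g_def case_prod_unfold)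
  have eps_pos: "\<epsilon> i > 0" for i
    using f(1)[of i] by (simp add: P_def \<epsilon>_def case_prod_unfold)
  have g_sep: "separates_levels X T (u i) n h" if "close (\<epsilon> i) h (g i)" for i h
    using f(1)[of i] that by (simp add: P_def g_def \<epsilon>_def case_prod_unfold)
  have g_step: "close (\<epsilon> i / 2) (g (Suc i)) (g i)" "\<epsilon> (Suc i) \<le> \<epsilon> i / 2" for i
    using f(2)[of i] by (simp_all add: Q_def g_def \<epsilon>_def case_prod_unfold)
  have dist: "\<bar>g (i + k) s x - g i s x\<bar> + \<epsilon> (i + k) \<le> \<epsilon> i" if s: "s < n" and x: "x \<in> topspace X" for i k s x
  proof (induction k)
    case (Suc k)
    have "\<bar>g (Suc (i + k)) s x - g (i + k) s x\<bar> \<le> \<epsilon> (i + k) / 2"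
      using g_step(1)[of "i + k"] s x by (simp add: close_def)
    then have "\<bar>g (Suc (i + k)) s x - g i s x\<bar> + \<epsilon> (Suc (i + k)) \<le> \<epsilon> i"
      using Suc g_step(2)[of "i + k"] by linarith
    then show ?case by simp
  qed simp
  have eps_le: "\<epsilon> i \<le> \<epsilon> 0 / 2 ^ i" for i
  proof (induction i)
    case (Suc i)
    then have "\<epsilon> (Suc i) \<le> (\<epsilon> 0 / 2 ^ i) / 2"
      by (intro order_trans[OF g_step(2)[of i]] divide_right_mono) simp_all
    then show ?case by (simp add: mult.commute)
  qed simp
  have eps_lim: "\<epsilon> \<longlonglongrightarrow> 0"
  proof (rule tendsto_sandwich[where f="\<lambda>_. 0" and h="\<lambda>i. \<epsilon> 0 / 2 ^ i"])
    show "(\<lambda>i. \<epsilon> 0 / 2 ^ i) \<longlonglongrightarrow> 0"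
      by (rule LIMSEQ_divide_realpow_zero) simp
  qed (use eps_le eps_pos in \<open>auto intro!: always_eventually less_imp_le\<close>)
  define h where "h s x = lim (\<lambda>k. g k s x)" for s x
  have conv: "(\<lambda>k. g k s x) \<longlonglongrightarrow> h s x" if s: "s < n" and x: "x \<in> topspace X" for s x
  proof -
    have "Cauchy (\<lambda>k. g k s x)"
    proof (rule CauchyI)
      fix e :: real assume "e > 0"
      then have "eventually (\<lambda>i. \<epsilon> i < e / 2) sequentially"
        using order_tendstoD(2)[OF eps_lim, of "e / 2"] by simp
      then obtain i where i: "\<epsilon> i < e / 2" by (auto simp: eventually_sequentially)
      have "\<bar>g k s x - g i s x\<bar> < e / 2" if "k \<ge> i" for k
        using dist[OF s x, of i "k - i"] eps_pos[of k] i that by simp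
      then have "norm (g k s x - g l s x) < e" if "k \<ge> i" "l \<ge> i" for k l
        using that by (smt (verit) field_sum_of_halves real_norm_def)
      then show "\<exists>M. \<forall>m\<ge>M. \<forall>k\<ge>M. norm (g m s x - g k s x) < e" by blast
    qed
    then show ?thesis
      unfolding h_def by (simp add: Cauchy_convergent_iff convergent_LIMSEQ_iff)
  qed
  have h_close: "\<bar>h s x - g i s x\<bar> \<le> \<epsilon> i" if s: "s < n" and x: "x \<in> topspace X" for i s x
  proof (rule LIMSEQ_le_const2)
    show "(\<lambda>k. \<bar>g k s x - g i s x\<bar>) \<longlonglongrightarrow> \<bar>h s x - g i s x\<bar>"
      by (intro tendsto_intros conv[OF s x])
    have "\<bar>g k s x - g i s x\<bar> \<le> \<epsilon> i" if "k \<ge> i" for k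
      using dist[OF s x, of i "k - i"] eps_pos[of k] that by simp
    then show "\<exists>N. \<forall>k\<ge>N. \<bar>g k s x - g i s x\<bar> \<le> \<epsilon> i" by blast
  qed
  have "continuous_map X euclideanreal (h s)" if s: "s < n" for s
  proof -
    have "\<forall>\<^sub>F i in sequentially. \<forall>x\<in>topspace X. h s x \<in> UNIV \<and> dist (g i s x) (h s x) < e" if "e > 0" for e
    proof -
      have "\<forall>\<^sub>F i in sequentially. \<epsilon> i < e" using order_tendstoD(2)[OF eps_lim that] .
      then show ?thesis
      proof (rule eventually_mono)
        fix i assume i: "\<epsilon> i < e"
        show "\<forall>x\<in>topspace X. h s x \<in> UNIV \<and> dist (g i s x) (h s x) < e"
        proof
          fix x assume x: "x \<in> topspace X"
          show "h s x \<in> UNIV \<and> dist (g i s x) (h s x) < e"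
            using h_close[OF s x, of i] i by (simp add: dist_real_def abs_minus_commute)
        qed
      qed
    qed
    then have "continuous_map X Met_TC.mtopology (h s)"
      using g_cont[OF s] by (intro Met_TC.continuous_map_uniform_limit[of X "\<lambda>i. g i s" sequentially]) auto
    then show ?thesis by simp
  qed
  moreover have "\<exists>s<n. \<exists>j. h s ((T ^^ j) x) \<noteq> h s ((T ^^ j) y)"
    if x: "x \<in> topspace X" and y: "y \<in> topspace X" and ne: "x \<noteq> y" for x y
  proof -
    obtain i where i: "u i x \<le> 0" "1 \<le> u i y" using u(2) x y ne by blast
    have "separates_levels X T (u i) n h"
      by (rule g_sep) (use h_close in \<open>auto simp: close_def\<close>)
    then show ?thesis using x y i unfolding separates_levels_def by blast
  qed
  ultimately show ?thesis by blast
qed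

lemma orbit_shift:
  assumes T: "\<And>x. x \<in> A \<Longrightarrow> T x \<in> A" and ST: "\<And>x. x \<in> A \<Longrightarrow> S (T x) = x" and x: "x \<in> A"
  shows "orbit T S (T x) k = orbit T S x (k + 1)"
proof (cases "0 \<le> k")
  case True
  then have "nat (k + 1) = Suc (nat k)" by simp
  then show ?thesis using True by (simp add: orbit_def funpow_swap1)
next
  case False
  then have "nat (- k) = Suc (nat (- (k + 1)))" by simp
  then have "(S ^^ nat (- k)) (T x) = (S ^^ nat (- (k + 1))) x"
    using ST[OF x] by (simp add: funpow_swap1)
  then show ?thesis using False by (cases "k = -1") (auto simp: orbit_def)
qed

lemma equivariant_embedding_exists:
  assumes X: "top_dyn_system X T" and D: "dyn_dim X T < of_nat D" and n: "n = 2 * D + 7"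
  shows "\<exists>F. equivariant_embedding X T (cube_shift_space n) shift_map F"
proof -
  obtain h :: "nat \<Rightarrow> 'a \<Rightarrow> real" where h: "\<forall>s<n. continuous_map X euclideanreal (h s)"
    "\<forall>x\<in>topspace X. \<forall>y\<in>topspace X. x \<noteq> y \<longrightarrow> (\<exists>s<n. \<exists>j. h s ((T ^^ j) x) \<noteq> h s ((T ^^ j) y))"
    using exists_separating_functions[OF X D n] by (elim exE conjE)
  have "homeomorphic_map X X T" using X by (simp add: top_dyn_system_def)
  then obtain S where "homeomorphic_maps X X T S" using homeomorphic_map_maps by blast
  then have contT: "continuous_map X X T" and contS: "continuous_map X X S"
    and ST: "\<And>x. x \<in> topspace X \<Longrightarrow> S (T x) = x"
    by (auto simp: homeomorphic_maps_def)
  have TX: "\<And>x. x \<in> topspace X \<Longrightarrow> T x \<in> topspace X"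
    using contT continuous_map_image_subset_topspace by blast
  have orbit_cont: "continuous_map X X (\<lambda>x. orbit T S x k)" for k
    using continuous_map_funpow[OF contT] continuous_map_funpow[OF contS] by (cases "0 \<le> k") (simp_all add: orbit_def)
  define c :: "real \<Rightarrow> real" where "c t = arctan t / pi + 1 / 2" for t
  have c_range: "c t \<in> {0..1}" for t
    using arctan_bounded[of t] pi_gt_zero by (auto simp: c_def field_simps)
  have c_cont: "continuous_on UNIV c"
    unfolding c_def by (intro continuous_intros) auto
  have c_inj: "c s = c t \<longleftrightarrow> s = t" for s t
    by (simp add: c_def arctan_eq_iff)
  define F where "F x k = restrict (\<lambda>s. c (h s (orbit T S x k))) {..<n}" for x k
  have "continuous_map X (cube_shift_space n) F"
    unfolding cube_shift_space_def cube_def continuous_map_componentwise_UNIV continuous_map_componentwise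
  proof (intro allI conjI ballI)
    fix k s assume "s \<in> {..<n}"
    then have s: "s < n" by simp
    have hc: "continuous_map X euclideanreal (h s \<circ> (\<lambda>x. orbit T S x k))"
      by (rule continuous_map_compose[OF orbit_cont]) (use h(1) s in blast)
    have "continuous_map euclideanreal (top_of_set {0..1}) c"
      using c_cont c_range by (auto simp: continuous_map_in_subtopology)
    from continuous_map_compose[OF hc this]
    show "continuous_map X (top_of_set {0..1}) (\<lambda>x. F x k s)"
      using s by (simp add: F_def o_def)
  qed (auto simp: F_def)
  moreover have "Hausdorff_space (cube_shift_space n)"
    unfolding cube_shift_space_def cube_def by (simp add: Hausdorff_space_product_topology Hausdorff_space_subtopology)
  moreover have "inj_on F (topspace X)"
  proof (rule inj_onI, rule ccontr)
    fix x y assume xy: "x \<in> topspace X" "y \<in> topspace X" "F x = F y" "x \<noteq> y"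
    then obtain s j where s: "s < n" "h s ((T ^^ j) x) \<noteq> h s ((T ^^ j) y)" using h(2) by blast
    have "F x (int j) s = F y (int j) s" using xy(3) by simp
    then show False using s c_inj by (simp add: F_def orbit_def)
  qed
  ultimately have "embedding_map X (cube_shift_space n) F"
    using X by (intro injective_closed_imp_embedding_map)
      (auto simp: top_dyn_system_def intro!: continuous_imp_closed_map_gen Hausdorff_imp_kc_space)
  moreover have "F (T x) = shift_map (F x)" if "x \<in> topspace X" for x
    by (rule ext) (simp add: F_def shift_map_def orbit_shift[where A="topspace X", OF TX ST that])
  ultimately show ?thesis unfolding equivariant_embedding_def by blast
qed

section \<open>Dimension of subsystems of cubical shifts\<close>

lemma resolve_neighbourhood:
  fixes h :: "'k \<Rightarrow> 'a \<Rightarrow> real"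
  assumes X: "compact_space X" and h: "\<And>\<kappa>. \<kappa> \<in> I \<Longrightarrow> continuous_map X euclideanreal (h \<kappa>)"
    and sep: "\<And>y. y \<in> topspace X \<Longrightarrow> y \<noteq> x \<Longrightarrow> \<exists>\<kappa>\<in>I. h \<kappa> x \<noteq> h \<kappa> y"
    and U: "openin X U" "x \<in> U"
  shows "\<exists>E \<epsilon>. finite E \<and> E \<subseteq> I \<and> \<epsilon> > 0 \<and> (\<forall>y\<in>topspace X. (\<forall>\<kappa>\<in>E. \<bar>h \<kappa> y - h \<kappa> x\<bar> < \<epsilon>) \<longrightarrow> y \<in> U)"
proof -
  let ?K = "topspace X - U"
  let ?G = "\<lambda>(\<kappa>, m). {y \<in> topspace X. \<bar>h \<kappa> y - h \<kappa> x\<bar> \<in> {1 / real (Suc m)<..}}"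
  have "closedin X ?K" using U(1) by blast
  then have K: "compactin X ?K" using X by (simp add: closedin_compact_space)
  have "openin X (?G i)" if i: "i \<in> I \<times> UNIV" for i
  proof -
    obtain \<kappa> m where \<kappa>: "i = (\<kappa>, m)" "\<kappa> \<in> I" using i by blast
    have "continuous_map X euclideanreal (\<lambda>y. \<bar>h \<kappa> y - h \<kappa> x\<bar>)"
      using h[OF \<kappa>(2)] by (intro continuous_map_real_abs continuous_map_diff) auto
    then show ?thesis
      unfolding \<kappa> prod.case by (rule openin_continuous_map_preimage) auto
  qed
  moreover have "?K \<subseteq> \<Union>(?G ` (I \<times> UNIV))"
  proof
    fix y assume y: "y \<in> ?K"
    then obtain \<kappa> where \<kappa>: "\<kappa> \<in> I" "h \<kappa> x \<noteq> h \<kappa> y" using sep[of y] U(2) by blast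
    then have "0 < \<bar>h \<kappa> y - h \<kappa> x\<bar>" by simp
    then obtain m where "1 / real (Suc m) < \<bar>h \<kappa> y - h \<kappa> x\<bar>" using nat_approx_posE by blast
    then have "y \<in> ?G (\<kappa>, m)" using y by simp
    then show "y \<in> \<Union>(?G ` (I \<times> UNIV))" using \<kappa>(1) by blast
  qed
  ultimately obtain F where F: "finite F" "F \<subseteq> I \<times> UNIV" "?K \<subseteq> \<Union>(?G ` F)"
    using compactin_finite_subcover[OF K, of "I \<times> UNIV" ?G] by blast
  define \<epsilon> where "\<epsilon> = Min (insert 1 ((\<lambda>(\<kappa>, m). 1 / real (Suc m)) ` F))"
  have pos: "\<epsilon> > 0" unfolding \<epsilon>_def using F(1) by (subst Min_gr_iff) auto
  have "y \<in> U" if y: "y \<in> topspace X" and close: "\<forall>\<kappa>\<in>fst ` F. \<bar>h \<kappa> y - h \<kappa> x\<bar> < \<epsilon>" for y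
  proof (rule ccontr)
    assume "y \<notin> U"
    then have "y \<in> \<Union>(?G ` F)" using y F(3) by blast
    then obtain \<kappa> m where \<kappa>: "(\<kappa>, m) \<in> F" "1 / real (Suc m) < \<bar>h \<kappa> y - h \<kappa> x\<bar>" by auto
    have "\<epsilon> \<le> 1 / real (Suc m)"
      unfolding \<epsilon>_def using F(1) \<kappa>(1) by (intro Min_le) force+
    moreover have "\<bar>h \<kappa> y - h \<kappa> x\<bar> < \<epsilon>" using close \<kappa>(1) by force
    ultimately show False using \<kappa>(2) by linarith
  qed
  then show ?thesis
    using F(1,2) pos by (intro exI[of _ "fst ` F"] exI[of _ \<epsilon>]) auto
qed

lemma resolve_cover:
  fixes h :: "'k \<Rightarrow> 'a \<Rightarrow> real"
  assumes X: "compact_space X" and h: "\<And>\<kappa>. \<kappa> \<in> I \<Longrightarrow> continuous_map X euclideanreal (h \<kappa>)"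
    and sep: "\<And>x y. x \<in> topspace X \<Longrightarrow> y \<in> topspace X \<Longrightarrow> y \<noteq> x \<Longrightarrow> \<exists>\<kappa>\<in>I. h \<kappa> x \<noteq> h \<kappa> y"
    and \<U>: "\<U> \<in> Cov X"
  shows "\<exists>E \<epsilon>. finite E \<and> E \<subseteq> I \<and> \<epsilon> > 0 \<and>
    (\<forall>x\<in>topspace X. \<exists>U\<in>\<U>. \<forall>y\<in>topspace X. (\<forall>\<kappa>\<in>E. \<bar>h \<kappa> y - h \<kappa> x\<bar> < \<epsilon>) \<longrightarrow> y \<in> U)"
proof -
  have "\<forall>x. \<exists>U E \<epsilon>. x \<in> topspace X \<longrightarrow> U \<in> \<U> \<and> finite E \<and> E \<subseteq> I \<and> \<epsilon> > 0 \<and>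
      (\<forall>y\<in>topspace X. (\<forall>\<kappa>\<in>E. \<bar>h \<kappa> y - h \<kappa> x\<bar> < \<epsilon>) \<longrightarrow> y \<in> U)"
  proof
    fix x
    show "\<exists>U E \<epsilon>. x \<in> topspace X \<longrightarrow> U \<in> \<U> \<and> finite E \<and> E \<subseteq> I \<and> \<epsilon> > 0 \<and>
      (\<forall>y\<in>topspace X. (\<forall>\<kappa>\<in>E. \<bar>h \<kappa> y - h \<kappa> x\<bar> < \<epsilon>) \<longrightarrow> y \<in> U)"
    proof (cases "x \<in> topspace X")
      case True
      then obtain U where U: "U \<in> \<U>" "openin X U" "x \<in> U" using \<U> unfolding Cov_def by blast
      have "\<exists>E \<epsilon>. finite E \<and> E \<subseteq> I \<and> \<epsilon> > 0 \<and> (\<forall>y\<in>topspace X. (\<forall>\<kappa>\<in>E. \<bar>h \<kappa> y - h \<kappa> x\<bar> < \<epsilon>) \<longrightarrow> y \<in> U)"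
        by (rule resolve_neighbourhood[OF X h sep U(2,3)]) (use True in auto)
      then show ?thesis using U(1) by (intro exI[of _ U]) simp
    qed simp
  qed
  then obtain U E \<epsilon> where c: "\<forall>x. x \<in> topspace X \<longrightarrow> U x \<in> \<U> \<and> finite (E x) \<and> E x \<subseteq> I \<and> \<epsilon> x > (0::real) \<and>
      (\<forall>y\<in>topspace X. (\<forall>\<kappa>\<in>E x. \<bar>h \<kappa> y - h \<kappa> x\<bar> < \<epsilon> x) \<longrightarrow> y \<in> U x)"
    unfolding choice_iff by (elim exE)
  let ?B = "\<lambda>x. topspace X \<inter> (\<Inter>\<kappa>\<in>E x. {y \<in> topspace X. h \<kappa> y \<in> ball (h \<kappa> x) (\<epsilon> x / 2)})"
  have "openin X (?B x)" if x: "x \<in> topspace X" for x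
  proof (cases "E x = {}")
    case False
    then have "openin X (\<Inter>\<kappa>\<in>E x. {y \<in> topspace X. h \<kappa> y \<in> ball (h \<kappa> x) (\<epsilon> x / 2)})"
      using c x by (intro openin_Inter) (auto intro!: openin_continuous_map_preimage[OF h] simp del: mem_ball)
    then show ?thesis by (intro openin_Int) auto
  qed auto
  moreover have "topspace X \<subseteq> \<Union>(?B ` topspace X)"
  proof
    fix x assume x: "x \<in> topspace X"
    then have "x \<in> ?B x" using c by simp
    then show "x \<in> \<Union>(?B ` topspace X)" using x by blast
  qed
  ultimately obtain Y where Y: "finite Y" "Y \<subseteq> topspace X" "topspace X \<subseteq> \<Union>(?B ` Y)"
    using compactin_finite_subcover[OF X[unfolded compact_space_def], of "topspace X" ?B] by blast
  define e where "e = Min (insert 1 ((\<lambda>x. \<epsilon> x / 2) ` Y))"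
  have "e > 0" unfolding e_def using Y(1,2) c by (subst Min_gr_iff) auto
  moreover have "finite (\<Union>(E ` Y))" using Y(1,2) c by auto
  moreover have "\<Union>(E ` Y) \<subseteq> I" using Y(2) c by blast
  moreover have "\<exists>V\<in>\<U>. \<forall>y\<in>topspace X. (\<forall>\<kappa>\<in>\<Union>(E ` Y). \<bar>h \<kappa> y - h \<kappa> x\<bar> < e) \<longrightarrow> y \<in> V"
    if x: "x \<in> topspace X" for x
  proof -
    obtain z where z: "z \<in> Y" "x \<in> ?B z" using Y(3) x by blast
    have zX: "z \<in> topspace X" using z Y(2) by blast
    have e: "e \<le> \<epsilon> z / 2" unfolding e_def using Y(1) z(1) by (intro Min_le) auto
    have "y \<in> U z" if y: "y \<in> topspace X" "\<forall>\<kappa>\<in>\<Union>(E ` Y). \<bar>h \<kappa> y - h \<kappa> x\<bar> < e" for y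
    proof -
      have "\<bar>h \<kappa> y - h \<kappa> z\<bar> < \<epsilon> z" if \<kappa>: "\<kappa> \<in> E z" for \<kappa>
      proof -
        have "\<bar>h \<kappa> y - h \<kappa> x\<bar> < e" using y(2) \<kappa> z(1) by blast
        moreover have "\<bar>h \<kappa> z - h \<kappa> x\<bar> < \<epsilon> z / 2" using z(2) \<kappa> by (simp add: dist_real_def)
        ultimately show ?thesis using e by linarith
      qed
      then show ?thesis using c zX y(1) by blast
    qed
    then show ?thesis using c zX by blast
  qed
  ultimately show ?thesis by blast
qed

definition int_dist :: "real \<Rightarrow> real" where
  "int_dist t = \<bar>t - of_int (round t)\<bar>"

lemma int_dist_le: "int_dist t \<le> \<bar>t - of_int z\<bar>"
  unfolding int_dist_def by (rule round_diff_minimal)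

lemma int_dist_less_iff: "int_dist t < \<delta> \<longleftrightarrow> (\<exists>z. \<bar>t - of_int z\<bar> < \<delta>)"
  using int_dist_le[of t] unfolding int_dist_def by (meson le_less_trans)

lemma floor_cell_iff:
  assumes "0 < s"
  shows "\<lfloor>t\<rfloor> = z \<and> s < int_dist t \<longleftrightarrow> of_int z + s < t \<and> t < of_int z + 1 - s"
proof
  assume a: "\<lfloor>t\<rfloor> = z \<and> s < int_dist t"
  then show "of_int z + s < t \<and> t < of_int z + 1 - s"
    using int_dist_le[of t z] int_dist_le[of t "z + 1"] floor_correct[of t] by auto
next
  assume a: "of_int z + s < t \<and> t < of_int z + 1 - s"
  then have "\<lfloor>t\<rfloor> = z" using assms by (intro floor_unique) auto
  moreover have "s < int_dist t"
  proof (cases "round t \<le> z")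
    case True
    then have "real_of_int (round t) \<le> of_int z" by simp
    then show ?thesis using a unfolding int_dist_def by linarith
  next
    case False
    then have "of_int z + 1 \<le> real_of_int (round t)" by linarith
    then show ?thesis using a unfolding int_dist_def by linarith
  qed
  ultimately show "\<lfloor>t\<rfloor> = z \<and> s < int_dist t" by simp
qed

lemma round_cell_iff:
  assumes "s \<le> 1 / 2"
  shows "round t = z \<and> int_dist t < s \<longleftrightarrow> \<bar>t - of_int z\<bar> < s"
proof
  assume a: "\<bar>t - of_int z\<bar> < s"
  then have "round t = z" using assms by (intro round_unique') auto
  then show "round t = z \<and> int_dist t < s" using a by (simp add: int_dist_def)
qed (auto simp: int_dist_def)

text \<open>With a common threshold, points at which several coordinates are near a cut could fail to lie
  in any cell. Thresholds growing with the number of near coordinates avoid this, and they leave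
  each point in at most one cell for each number of near coordinates.\<close>

lemma threshold_exists:
  fixes f :: "'k \<Rightarrow> real" and t :: "nat \<Rightarrow> real"
  assumes E: "finite E" and s: "\<And>j. t j < s j" "\<And>j. s j < t (Suc j)"
  shows "\<exists>j\<le>card E. card {\<kappa>\<in>E. f \<kappa> < s j} = j \<and> (\<forall>\<kappa>\<in>E. f \<kappa> \<noteq> s j)"
proof -
  let ?A = "\<lambda>r. card {\<kappa>\<in>E. f \<kappa> < r}"
  define J where "J = {j. j \<le> card E \<and> j \<le> ?A (t j)}"
  define j where "j = Max J"
  have "finite J" "0 \<in> J" by (auto simp: J_def)
  then have j: "j \<in> J" "\<And>i. i \<in> J \<Longrightarrow> i \<le> j" unfolding j_def by (auto intro: Max_in)
  have upper: "?A (t (Suc j)) \<le> j"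
  proof (cases "j = card E")
    case True
    then show ?thesis using E by (auto intro: card_mono)
  next
    case False
    then have "Suc j \<le> card E" using j(1) by (simp add: J_def)
    moreover have "Suc j \<notin> J" using j(2)[of "Suc j"] by auto
    ultimately show ?thesis by (simp add: J_def)
  qed
  have fin: "finite {\<kappa>\<in>E. f \<kappa> < s j}" "finite {\<kappa>\<in>E. f \<kappa> \<le> s j}" "finite {\<kappa>\<in>E. f \<kappa> < t (Suc j)}"
    using E by auto
  have "j \<le> ?A (t j)" using j(1) by (simp add: J_def)
  also have "?A (t j) \<le> ?A (s j)" using s(1)[of j] by (intro card_mono fin) auto
  finally have lower: "j \<le> ?A (s j)" .
  have "?A (s j) \<le> card {\<kappa>\<in>E. f \<kappa> \<le> s j}" by (intro card_mono fin) auto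
  moreover have "card {\<kappa>\<in>E. f \<kappa> \<le> s j} \<le> ?A (t (Suc j))"
    using s(2)[of j] by (intro card_mono fin) auto
  ultimately have eq: "?A (s j) = j" "card {\<kappa>\<in>E. f \<kappa> \<le> s j} = j" using lower upper by linarith+
  have same: "{\<kappa>\<in>E. f \<kappa> < s j} = {\<kappa>\<in>E. f \<kappa> \<le> s j}"
    by (rule card_subset_eq[OF fin(2)]) (use eq in auto)
  have "f \<kappa> \<noteq> s j" if "\<kappa> \<in> E" for \<kappa>
  proof
    assume "f \<kappa> = s j"
    then have "\<kappa> \<in> {\<kappa>\<in>E. f \<kappa> < s j}" unfolding same using that by simp
    then show False using \<open>f \<kappa> = s j\<close> by simp
  qed
  then show ?thesis using eq(1) j(1) by (auto simp: J_def)
qed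

lemma grid_cover:
  fixes w :: "'k \<Rightarrow> 'a \<Rightarrow> real"
  assumes E: "finite E" and w: "\<And>\<kappa>. \<kappa> \<in> E \<Longrightarrow> continuous_map X euclideanreal (w \<kappa>)"
    and B: "\<And>\<kappa> x. \<kappa> \<in> E \<Longrightarrow> x \<in> topspace X \<Longrightarrow> \<bar>w \<kappa> x\<bar> \<le> B"
    and \<delta>: "0 < \<delta>" "\<delta> \<le> 1 / 2"
  shows "\<exists>V\<in>Cov X. (\<forall>v\<in>V. \<forall>x\<in>v. \<forall>y\<in>v. \<forall>\<kappa>\<in>E. \<bar>w \<kappa> x - w \<kappa> y\<bar> < 1) \<and>
    (\<forall>x\<in>topspace X. ord_at V x \<le> card {\<kappa>\<in>E. int_dist (w \<kappa> x) < \<delta>})"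
proof -
  define m where "m = card E"
  define q where "q = \<delta> / real (m + 1)"
  define t where "t j = q * real j" for j
  define s where "s j = q * (real j + 1 / 2)" for j
  have q: "0 < q" using \<delta>(1) by (simp add: q_def)
  have ts: "t j < s j" "s j < t (Suc j)" for j
    using q by (simp_all add: t_def s_def algebra_simps)
  have s_pos: "0 < s j" for j using q by (simp add: s_def)
  have s_less: "s j < \<delta>" if "j \<le> m" for j
  proof -
    have "t (Suc j) \<le> q * real (m + 1)"
      unfolding t_def using that q by (intro mult_left_mono) auto
    also have "\<dots> = \<delta>" by (simp add: q_def)
    finally show ?thesis using ts(2)[of j] by linarith
  qed
  define code where "code j x = restrict (\<lambda>\<kappa>. if int_dist (w \<kappa> x) < s j then (True, round (w \<kappa> x))
      else (False, \<lfloor>w \<kappa> x\<rfloor>)) E" for j x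
  define cell where "cell j c = {x \<in> topspace X. (\<forall>\<kappa>\<in>E. int_dist (w \<kappa> x) \<noteq> s j) \<and>
      card {\<kappa>\<in>E. int_dist (w \<kappa> x) < s j} = j \<and> code j x = c}" for j c
  define b where "b = \<lceil>B\<rceil> + 1"
  define C where "C = PiE E (\<lambda>_. (UNIV :: bool set) \<times> {- b..b})"
  define V where "V = (\<lambda>(j, c). cell j c) ` ({..m} \<times> C)"
  have "finite C" unfolding C_def using E by (intro finite_PiE) auto
  then have fin: "finite V" by (simp add: V_def)
  have code_C: "code j x \<in> C" if x: "x \<in> topspace X" for j x
  proof -
    have "round (w \<kappa> x) \<in> {- b..b} \<and> \<lfloor>w \<kappa> x\<rfloor> \<in> {- b..b}" if "\<kappa> \<in> E" for \<kappa>
    proof -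
      have bound: "\<bar>w \<kappa> x\<bar> \<le> B" using B[OF that x] .
      have b: "real_of_int b = of_int \<lceil>B\<rceil> + 1" "B \<le> of_int \<lceil>B\<rceil>" by (simp_all add: b_def)
      have "z \<in> {- b..b}" if z: "\<bar>w \<kappa> x - of_int z\<bar> \<le> 1" for z
      proof -
        have "real_of_int z \<le> real_of_int b" "real_of_int (- b) \<le> real_of_int z"
          using z bound b by (simp_all only: of_int_minus)
        then show ?thesis unfolding of_int_le_iff by simp
      qed
      moreover have "\<bar>w \<kappa> x - of_int (round (w \<kappa> x))\<bar> \<le> 1"
        using of_int_round_abs_le[of "w \<kappa> x"] by linarith
      moreover have "\<bar>w \<kappa> x - of_int \<lfloor>w \<kappa> x\<rfloor>\<bar> \<le> 1"
        using floor_correct[of "w \<kappa> x"] by linarith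
      ultimately show ?thesis by blast
    qed
    then show ?thesis unfolding C_def code_def by auto
  qed
  have code_set: "{\<kappa>\<in>E. fst (code j x \<kappa>)} = {\<kappa>\<in>E. int_dist (w \<kappa> x) < s j}" for j x
    by (auto simp: code_def split: if_splits)
  have open_cell: "openin X (cell j c)" if j: "j \<le> m" and c: "c \<in> C" for j c
  proof (cases "card {\<kappa>\<in>E. fst (c \<kappa>)} = j")
    case False
    have "cell j c = {}"
    proof (rule equals0I)
      fix x assume x: "x \<in> cell j c"
      then have "card {\<kappa>\<in>E. int_dist (w \<kappa> x) < s j} = j" "code j x = c" by (simp_all add: cell_def)
      then show False using code_set[of j x] False by simp
    qed
    then show ?thesis by simp
  next
    case True
    define P where "P \<kappa> = (if fst (c \<kappa>) then {of_int (snd (c \<kappa>)) - s j<..<of_int (snd (c \<kappa>)) + s j}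
        else {of_int (snd (c \<kappa>)) + s j<..<of_int (snd (c \<kappa>)) + 1 - s j})" for \<kappa>
    have half: "s j \<le> 1 / 2" using s_less[OF j] \<delta>(2) by linarith
    have P_iff: "w \<kappa> x \<in> P \<kappa> \<longleftrightarrow> int_dist (w \<kappa> x) \<noteq> s j \<and> code j x \<kappa> = c \<kappa>" if "\<kappa> \<in> E" for \<kappa> x
    proof -
      have "code j x \<kappa> = (if int_dist (w \<kappa> x) < s j then (True, round (w \<kappa> x)) else (False, \<lfloor>w \<kappa> x\<rfloor>))"
        using that by (simp add: code_def)
      then show ?thesis
        using round_cell_iff[OF half, of "w \<kappa> x" "snd (c \<kappa>)"] floor_cell_iff[OF s_pos[of j], of "w \<kappa> x" "snd (c \<kappa>)"]
        by (cases "c \<kappa>") (auto simp: P_def abs_less_iff)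
    qed
    have "cell j c = topspace X \<inter> (\<Inter>\<kappa>\<in>E. {x \<in> topspace X. w \<kappa> x \<in> P \<kappa>})"
    proof (rule set_eqI)
      fix x
      have "(\<forall>\<kappa>\<in>E. w \<kappa> x \<in> P \<kappa>) \<longleftrightarrow> (\<forall>\<kappa>\<in>E. int_dist (w \<kappa> x) \<noteq> s j) \<and> code j x = c"
      proof -
        have "code j x = c \<longleftrightarrow> (\<forall>\<kappa>\<in>E. code j x \<kappa> = c \<kappa>)"
        proof
          assume eq: "\<forall>\<kappa>\<in>E. code j x \<kappa> = c \<kappa>"
          have "code j x \<in> extensional E" "c \<in> extensional E"
            using c unfolding C_def code_def by (simp_all add: PiE_iff)
          then show "code j x = c" by (rule extensionalityI) (use eq in blast)
        qed simp
        then show ?thesis by (simp add: P_iff ball_conj_distrib)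
      qed
      moreover have "card {\<kappa>\<in>E. int_dist (w \<kappa> x) < s j} = j" if "code j x = c"
      proof -
        show ?thesis using code_set[of j x] that True by simp
      qed
      ultimately show "x \<in> cell j c \<longleftrightarrow> x \<in> topspace X \<inter> (\<Inter>\<kappa>\<in>E. {x \<in> topspace X. w \<kappa> x \<in> P \<kappa>})"
        unfolding cell_def by blast
    qed
    moreover have "openin X (topspace X \<inter> (\<Inter>\<kappa>\<in>E. {x \<in> topspace X. w \<kappa> x \<in> P \<kappa>}))"
    proof (cases "E = {}")
      case False
      have "openin X {x \<in> topspace X. w \<kappa> x \<in> P \<kappa>}" if "\<kappa> \<in> E" for \<kappa>
        by (rule openin_continuous_map_preimage[OF w[OF that]]) (auto simp: P_def)
      then show ?thesis using E False by (intro openin_Int openin_Inter) auto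
    qed auto
    ultimately show ?thesis by simp
  qed
  have "\<Union>V = topspace X"
  proof
    show "\<Union>V \<subseteq> topspace X" by (auto simp: V_def cell_def)
    show "topspace X \<subseteq> \<Union>V"
    proof
      fix x assume x: "x \<in> topspace X"
      obtain j where j: "j \<le> m" "card {\<kappa>\<in>E. int_dist (w \<kappa> x) < s j} = j" "\<forall>\<kappa>\<in>E. int_dist (w \<kappa> x) \<noteq> s j"
        using threshold_exists[where t=t and s=s and f="\<lambda>\<kappa>. int_dist (w \<kappa> x)", OF E ts] unfolding m_def by blast
      then have "x \<in> cell j (code j x)" using x by (simp add: cell_def)
      moreover have "cell j (code j x) \<in> V" using j(1) code_C[OF x] by (auto simp: V_def)
      ultimately show "x \<in> \<Union>V" by blast
    qed
  qed
  moreover have "openin X v" if "v \<in> V" for v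
    using that open_cell unfolding V_def by auto
  ultimately have "V \<in> Cov X" using fin by (simp add: Cov_def)
  moreover have "\<bar>w \<kappa> x - w \<kappa> y\<bar> < 1" if v: "v \<in> V" "x \<in> v" "y \<in> v" and \<kappa>: "\<kappa> \<in> E" for v x y \<kappa>
  proof -
    obtain j c where jc: "v = cell j c" "j \<le> m" using v(1) by (auto simp: V_def)
    have "code j x \<kappa> = code j y \<kappa>" using v(2,3) unfolding jc cell_def by simp
    then have "int_dist (w \<kappa> x) < s j \<and> int_dist (w \<kappa> y) < s j \<and> round (w \<kappa> x) = round (w \<kappa> y) \<or> \<lfloor>w \<kappa> x\<rfloor> = \<lfloor>w \<kappa> y\<rfloor>"
      using \<kappa> by (auto simp: code_def split: if_splits)
    then show ?thesis
    proof
      assume "int_dist (w \<kappa> x) < s j \<and> int_dist (w \<kappa> y) < s j \<and> round (w \<kappa> x) = round (w \<kappa> y)"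
      then show ?thesis using s_less[OF jc(2)] \<delta>(2) unfolding int_dist_def by linarith
    next
      assume "\<lfloor>w \<kappa> x\<rfloor> = \<lfloor>w \<kappa> y\<rfloor>"
      then show ?thesis using floor_correct[of "w \<kappa> x"] floor_correct[of "w \<kappa> y"] by linarith
    qed
  qed
  moreover have "ord_at V x \<le> card {\<kappa>\<in>E. int_dist (w \<kappa> x) < \<delta>}" if x: "x \<in> topspace X" for x
  proof -
    let ?n = "card {\<kappa>\<in>E. int_dist (w \<kappa> x) < \<delta>}"
    have "{v\<in>V. x \<in> v} \<subseteq> (\<lambda>j. cell j (code j x)) ` {..?n}"
    proof
      fix v assume "v \<in> {v\<in>V. x \<in> v}"
      then obtain j c where jc: "v = cell j c" "j \<le> m" "x \<in> cell j c" by (auto simp: V_def)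
      then have c: "c = code j x" and "j = card {\<kappa>\<in>E. int_dist (w \<kappa> x) < s j}" by (auto simp: cell_def)
      moreover have "card {\<kappa>\<in>E. int_dist (w \<kappa> x) < s j} \<le> ?n"
        using s_less[OF jc(2)] E by (intro card_mono) auto
      ultimately have "j \<in> {..?n}" by simp
      then show "v \<in> (\<lambda>j. cell j (code j x)) ` {..?n}" unfolding jc(1) c by (rule imageI)
    qed
    then have "card {v\<in>V. x \<in> v} \<le> card ((\<lambda>j. cell j (code j x)) ` {..?n})"
      by (intro card_mono) auto
    also have "\<dots> \<le> Suc ?n" using card_image_le[of "{..?n}" "\<lambda>j. cell j (code j x)"] by simp
    finally show ?thesis by (simp add: ord_at_def)
  qed
  ultimately show ?thesis by blast
qed

lemma int_dist_shift_unique: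
  fixes a :: real
  assumes M: "M > 0" and k: "k \<in> {0..<int M}" "k' \<in> {0..<int M}"
    and d: "int_dist (a - of_int k / M) < 1 / (2 * M)" "int_dist (a - of_int k' / M) < 1 / (2 * M)"
  shows "k = k'"
proof -
  obtain z z' where z: "\<bar>a - of_int k / M - of_int z\<bar> < 1 / (2 * real M)" "\<bar>a - of_int k' / M - of_int z'\<bar> < 1 / (2 * real M)"
    using d unfolding int_dist_less_iff by blast
  have "\<bar>(of_int k' / M + of_int z') - (of_int k / M + of_int z)\<bar> < 1 / (2 * real M) + 1 / (2 * real M)"
    using z by linarith
  then have "\<bar>(of_int k' / M + of_int z') - (of_int k / M + of_int z)\<bar> < 1 / M" by simp
  moreover have "(of_int k' / M + of_int z') - (of_int k / M + of_int z) = of_int ((k' - k) + (z' - z) * int M) / M"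
    using M by (simp add: field_simps)
  ultimately have "\<bar>of_int ((k' - k) + (z' - z) * int M) :: real\<bar> / M < 1 / M"
    by (simp add: abs_divide)
  then have "\<bar>of_int ((k' - k) + (z' - z) * int M) :: real\<bar> < 1"
    using M by (simp add: divide_less_cancel)
  then have eq: "k' - k = - (z' - z) * int M" by linarith
  then have "int M dvd k' - k" by (metis dvd_triv_right)
  moreover have "\<bar>k' - k\<bar> < int M" using k by auto
  ultimately show ?thesis using zdvd_not_zless[of "\<bar>k' - k\<bar>" "int M"] by force
qed

lemma embedded_system_small_order:
  assumes X: "top_dyn_system X T" and F: "equivariant_embedding X T (cube_shift_space n) shift_map F"
    and \<U>: "\<U> \<in> Cov X"
  shows "\<exists>V\<in>Cov X. refines V \<U> \<and> ord_dyn X T V \<le> of_nat n"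
proof -
  have compact: "compact_space X" using X by (simp add: top_dyn_system_def)
  have emb: "embedding_map X (cube_shift_space n) F" and FT: "\<And>x. x \<in> topspace X \<Longrightarrow> F (T x) = shift_map (F x)"
    using F by (auto simp: equivariant_embedding_def)
  have hom: "homeomorphic_map X (subtopology (cube_shift_space n) (F ` topspace X)) F"
    using emb by (simp add: embedding_map_def)
  have contF: "continuous_map X (cube_shift_space n) F"
    using homeomorphic_imp_continuous_map[OF hom] by (simp add: continuous_map_in_subtopology)
  have inj: "inj_on F (topspace X)"
    using homeomorphic_imp_injective_map[OF hom] .
  have contFk: "continuous_map X (cube n) (\<lambda>x. F x k)" for k
    using contF unfolding cube_shift_space_def continuous_map_componentwise_UNIV by blast
  have contFki: "continuous_map X (top_of_set {0..1}) (\<lambda>x. F x k i)" if "i < n" for k i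
    using contFk[of k] that unfolding cube_def continuous_map_componentwise by blast
  have F01: "F x k i \<in> {0..1}" if "i < n" "x \<in> topspace X" for x k i
    using contFki[OF that(1), of k] that(2) by (auto simp: continuous_map_def)
  have Fext: "F x k \<in> extensional {..<n}" if "x \<in> topspace X" for x k
    using contFk[of k] that unfolding cube_def continuous_map_componentwise by blast
  define I where "I = (UNIV :: int set) \<times> {..<n}"
  define h where "h = (\<lambda>(k, i) x. F x k i)"
  have h_cont: "continuous_map X euclideanreal (h \<kappa>)" if "\<kappa> \<in> I" for \<kappa>
  proof -
    obtain k i where \<kappa>: "\<kappa> = (k, i)" "i < n" using \<open>\<kappa> \<in> I\<close> by (auto simp: I_def)
    show ?thesis
      using contFki[OF \<kappa>(2), of k] unfolding \<kappa>(1) h_def prod.case by (simp add: continuous_map_in_subtopology)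
  qed
  have h01: "h \<kappa> x \<in> {0..1}" if "\<kappa> \<in> I" "x \<in> topspace X" for \<kappa> x
    using that F01 by (auto simp: I_def h_def)
  have h_sep: "\<exists>\<kappa>\<in>I. h \<kappa> x \<noteq> h \<kappa> y" if xy: "x \<in> topspace X" "y \<in> topspace X" "y \<noteq> x" for x y
  proof -
    have "F x \<noteq> F y" using inj xy by (auto dest: inj_onD)
    then obtain k where k: "F x k \<noteq> F y k" by blast
    have "\<exists>i<n. F x k i \<noteq> F y k i"
    proof (rule ccontr)
      assume "\<not> ?thesis"
      then have "F x k = F y k" by (intro extensionalityI[OF Fext[OF xy(1)] Fext[OF xy(2)]]) auto
      then show False using k by simp
    qed
    then obtain i where "i < n" "F x k i \<noteq> F y k i" by blast
    then show ?thesis by (intro bexI[of _ "(k, i)"]) (auto simp: I_def h_def)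
  qed
  have "\<exists>E \<epsilon>. finite E \<and> E \<subseteq> I \<and> \<epsilon> > 0 \<and>
    (\<forall>x\<in>topspace X. \<exists>U\<in>\<U>. \<forall>y\<in>topspace X. (\<forall>\<kappa>\<in>E. \<bar>h \<kappa> y - h \<kappa> x\<bar> < \<epsilon>) \<longrightarrow> y \<in> U)"
    by (rule resolve_cover[OF compact h_cont h_sep \<U>])
  then obtain E \<epsilon> where E: "finite E" "E \<subseteq> I" and \<epsilon>: "\<epsilon> > 0"
    and resolve: "\<forall>x\<in>topspace X. \<exists>U\<in>\<U>. \<forall>y\<in>topspace X. (\<forall>\<kappa>\<in>E. \<bar>h \<kappa> y - h \<kappa> x\<bar> < \<epsilon>) \<longrightarrow> y \<in> U"
    by (elim exE conjE)
  define m where "m = Suc (nat (Max (insert 0 ((\<lambda>\<kappa>. \<bar>fst \<kappa>\<bar>) ` E))))"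
  have m: "\<bar>fst \<kappa>\<bar> < int m" if "\<kappa> \<in> E" for \<kappa>
  proof -
    have "\<bar>fst \<kappa>\<bar> \<le> Max (insert 0 ((\<lambda>\<kappa>. \<bar>fst \<kappa>\<bar>) ` E))"
      using E(1) that by (intro Max_ge) auto
    then show ?thesis unfolding m_def by arith
  qed
  define M where "M = 2 * m"
  have M: "M > 0" by (simp add: M_def m_def)
  define \<delta> where "\<delta> = 1 / (2 * real M)"
  have \<delta>: "0 < \<delta>" "\<delta> \<le> 1 / 2" using M by (simp_all add: \<delta>_def divide_simps)
  define v where "v k t = t / \<epsilon> - of_int (k + int m) / real M" for k t
  define w where "w \<kappa> x = v (fst \<kappa>) (h \<kappa> x)" for \<kappa> x
  have w_cont: "continuous_map X euclideanreal (w \<kappa>)" if "\<kappa> \<in> E" for \<kappa>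
  proof -
    have "continuous_map X euclideanreal (h \<kappa>)" using h_cont that E(2) by blast
    then show ?thesis
      unfolding w_def v_def using \<epsilon> M by (intro continuous_map_diff continuous_map_real_divide) auto
  qed
  have w_bound: "\<bar>w \<kappa> x\<bar> \<le> 1 / \<epsilon> + 1" if "\<kappa> \<in> E" "x \<in> topspace X" for \<kappa> x
  proof -
    have "0 \<le> h \<kappa> x / \<epsilon>" "h \<kappa> x / \<epsilon> \<le> 1 / \<epsilon>"
      using h01[of \<kappa> x] that E(2) \<epsilon> by (auto simp: divide_right_mono)
    moreover have "0 \<le> fst \<kappa> + int m" "fst \<kappa> + int m \<le> int M"
      using m[OF that(1)] by (auto simp: M_def)
    then have "0 \<le> of_int (fst \<kappa> + int m) / real M" "of_int (fst \<kappa> + int m) / real M \<le> 1"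
      using M by (simp_all add: divide_le_eq_1)
    ultimately show ?thesis unfolding w_def v_def by linarith
  qed
  have "\<exists>V\<in>Cov X. (\<forall>v\<in>V. \<forall>x\<in>v. \<forall>y\<in>v. \<forall>\<kappa>\<in>E. \<bar>w \<kappa> x - w \<kappa> y\<bar> < 1) \<and>
    (\<forall>x\<in>topspace X. ord_at V x \<le> card {\<kappa>\<in>E. int_dist (w \<kappa> x) < \<delta>})"
    by (rule grid_cover[OF E(1) w_cont w_bound \<delta>])
  then obtain V where V: "V \<in> Cov X" and small: "\<forall>v\<in>V. \<forall>x\<in>v. \<forall>y\<in>v. \<forall>\<kappa>\<in>E. \<bar>w \<kappa> x - w \<kappa> y\<bar> < 1"
    and ord: "\<forall>x\<in>topspace X. ord_at V x \<le> card {\<kappa>\<in>E. int_dist (w \<kappa> x) < \<delta>}"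
    by (elim bexE conjE)
  have "refines V \<U>"
    unfolding refines_def
  proof
    fix v' assume v': "v' \<in> V"
    show "\<exists>U\<in>\<U>. v' \<subseteq> U"
    proof (cases "v' = {}")
      case True
      have "\<U> \<noteq> {}" using X \<U> unfolding top_dyn_system_def Cov_def by blast
      then show ?thesis using True by blast
    next
      case False
      then obtain x where x: "x \<in> v'" by blast
      have sub: "v' \<subseteq> topspace X" using V v' by (auto simp: Cov_def)
      then obtain U where U: "U \<in> \<U>" "\<forall>y\<in>topspace X. (\<forall>\<kappa>\<in>E. \<bar>h \<kappa> y - h \<kappa> x\<bar> < \<epsilon>) \<longrightarrow> y \<in> U"
        using resolve x by blast
      have "y \<in> U" if y: "y \<in> v'" for y
      proof -
        have "\<bar>h \<kappa> y - h \<kappa> x\<bar> < \<epsilon>" if "\<kappa> \<in> E" for \<kappa>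
        proof -
          have "\<bar>w \<kappa> y - w \<kappa> x\<bar> < 1" using small v' x y that by blast
          moreover have "w \<kappa> y - w \<kappa> x = (h \<kappa> y - h \<kappa> x) / \<epsilon>"
            by (simp add: w_def v_def diff_divide_distrib)
          ultimately have "\<bar>h \<kappa> y - h \<kappa> x\<bar> / \<epsilon> < 1" using \<epsilon> by (simp add: abs_divide)
          then show ?thesis using \<epsilon> by (simp add: divide_less_eq_1)
        qed
        then show ?thesis using U(2) sub y by blast
      qed
      then show ?thesis using U(1) by blast
    qed
  qed
  moreover have "ord_dyn X T V \<le> of_nat n"
    unfolding ord_dyn_def
  proof (rule SUP_least)
    fix \<mu> assume \<mu>: "\<mu> \<in> inv_prob X T"
    interpret prob_space \<mu> using \<mu> by (simp add: inv_prob_def)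
    have sets: "sets \<mu> = sigma_sets (topspace X) {U. openin X U}"
      and space: "space \<mu> = topspace X"
      using inv_prob_sets_space[OF \<mu>] by simp_all
    define D where "D k i H = {x \<in> topspace X. F x k i \<in> H}" for k :: int and i :: nat and H :: "real set"
    have D_sets: "D k i H \<in> sets \<mu>" if "i < n" "open H" for k i H
    proof -
      have "continuous_map X euclideanreal (\<lambda>x. F x k i)"
        using contFki[OF that(1)] by (simp add: continuous_map_in_subtopology)
      then have "openin X (D k i H)"
        unfolding D_def by (rule openin_continuous_map_preimage) (use that(2) in simp)
      then show ?thesis unfolding sets by blast
    qed
    have TX: "\<And>x. x \<in> topspace X \<Longrightarrow> T x \<in> topspace X"
      using top_dyn_system_funpow[OF X, of _ 1] by simp
    \<comment> \<open>By invariance every coordinate \<open>(k, i)\<close> may be moved to time \<open>0\<close>, where the cuts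
      of different \<open>k\<close> are disjoint; hence the bound does not grow with the window.\<close>
    have D_Suc: "emeasure \<mu> (D (k + 1) i H) = emeasure \<mu> (D k i H)" if "i < n" "open H" for k i H
    proof -
      have "D (k + 1) i H = T -` D k i H \<inter> space \<mu>"
        unfolding space D_def using FT TX by (auto simp: shift_map_def)
      then show ?thesis using \<mu> D_sets[OF that, of k] by (simp add: inv_prob_def)
    qed
    have D_0: "emeasure \<mu> (D k i H) = emeasure \<mu> (D 0 i H)" if "i < n" "open H" for k i H
    proof (induction k rule: int_induct[where k = 0])
      case (step1 k)
      then show ?case using D_Suc[OF that, of k] by simp
    next
      case (step2 k)
      then show ?case using D_Suc[OF that, of "k - 1"] by simp
    qed simp
    define H where "H k = {t. int_dist (v k t) < \<delta>}" for k
    have H_open: "open (H k)" for k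
    proof -
      have "H k = (\<Union>z. {t. \<bar>v k t - of_int z\<bar> < \<delta>})"
        unfolding H_def int_dist_less_iff by blast
      moreover have "open {t. \<bar>v k t - of_int z\<bar> < \<delta>}" for z
        unfolding v_def using \<epsilon> by (intro open_Collect_less continuous_intros) auto
      ultimately show ?thesis by auto
    qed
    have near: "{x \<in> topspace X. int_dist (w (k, i) x) < \<delta>} = D k i (H k)" for k i
      by (simp add: D_def H_def w_def h_def)
    let ?J = "{- int m..<int m}"
    have EJ: "E \<subseteq> ?J \<times> {..<n}"
    proof
      fix \<kappa> assume \<kappa>: "\<kappa> \<in> E"
      then show "\<kappa> \<in> ?J \<times> {..<n}"
        using m[OF \<kappa>] E(2) by (cases \<kappa>) (auto simp: I_def)
    qed
    have ind: "of_nat (ord_at V x) \<le> (\<Sum>\<kappa>\<in>E. indicator (D (fst \<kappa>) (snd \<kappa>) (H (fst \<kappa>))) x :: ennreal)"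
      if x: "x \<in> topspace X" for x
    proof -
      have "of_nat (ord_at V x) \<le> (of_nat (card {\<kappa>\<in>E. int_dist (w \<kappa> x) < \<delta>}) :: ennreal)"
        using ord x by (intro of_nat_mono) blast
      also have "\<dots> = (\<Sum>\<kappa>\<in>E. of_bool (int_dist (w \<kappa> x) < \<delta>))"
        using E(1) by (simp add: of_bool_def sum.If_cases Int_def)
      also have "\<dots> = (\<Sum>\<kappa>\<in>E. indicator (D (fst \<kappa>) (snd \<kappa>) (H (fst \<kappa>))) x)"
      proof (rule sum.cong[OF refl])
        fix \<kappa>
        show "of_bool (int_dist (w \<kappa> x) < \<delta>) = (indicator (D (fst \<kappa>) (snd \<kappa>) (H (fst \<kappa>))) x :: ennreal)"
          using near[of "fst \<kappa>" "snd \<kappa>"] x by (auto simp: indicator_def set_eq_iff)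
      qed
      finally show ?thesis .
    qed
    have "(\<integral>\<^sup>+ x. of_nat (ord_at V x) \<partial>\<mu>)
        \<le> (\<integral>\<^sup>+ x. (\<Sum>\<kappa>\<in>E. indicator (D (fst \<kappa>) (snd \<kappa>) (H (fst \<kappa>))) x) \<partial>\<mu>)"
      by (rule nn_integral_mono) (use ind in \<open>simp add: space\<close>)
    also have "\<dots> = (\<Sum>\<kappa>\<in>E. emeasure \<mu> (D (fst \<kappa>) (snd \<kappa>) (H (fst \<kappa>))))"
    proof -
      have meas: "D (fst \<kappa>) (snd \<kappa>) (H (fst \<kappa>)) \<in> sets \<mu>" if "\<kappa> \<in> E" for \<kappa>
        using EJ that by (intro D_sets H_open) auto
      then have "(\<integral>\<^sup>+ x. (\<Sum>\<kappa>\<in>E. indicator (D (fst \<kappa>) (snd \<kappa>) (H (fst \<kappa>))) x) \<partial>\<mu>)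
          = (\<Sum>\<kappa>\<in>E. \<integral>\<^sup>+ x. indicator (D (fst \<kappa>) (snd \<kappa>) (H (fst \<kappa>))) x \<partial>\<mu>)"
        by (intro nn_integral_sum) auto
      also have "\<dots> = (\<Sum>\<kappa>\<in>E. emeasure \<mu> (D (fst \<kappa>) (snd \<kappa>) (H (fst \<kappa>))))"
        using meas by (intro sum.cong) auto
      finally show ?thesis .
    qed
    also have "\<dots> = (\<Sum>\<kappa>\<in>E. emeasure \<mu> (D 0 (snd \<kappa>) (H (fst \<kappa>))))"
      using EJ by (intro sum.cong D_0 H_open) auto
    also have "\<dots> \<le> (\<Sum>\<kappa>\<in>?J \<times> {..<n}. emeasure \<mu> (D 0 (snd \<kappa>) (H (fst \<kappa>))))"
      using EJ by (intro sum_mono2) auto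
    also have "\<dots> = (\<Sum>k\<in>?J. \<Sum>i<n. emeasure \<mu> (D 0 i (H k)))"
      by (simp add: sum.cartesian_product')
    also have "\<dots> = (\<Sum>i<n. \<Sum>k\<in>?J. emeasure \<mu> (D 0 i (H k)))"
      by (rule sum.swap)
    also have "\<dots> \<le> (\<Sum>i<n. 1)"
    proof (rule sum_mono)
      fix i assume "i \<in> {..<n}"
      then have i: "i < n" by simp
      have "disjoint_family_on (\<lambda>k. D 0 i (H k)) ?J"
        unfolding disjoint_family_on_def
      proof (intro ballI impI)
        fix k k' assume k: "k \<in> ?J" "k' \<in> ?J" "k \<noteq> k'"
        show "D 0 i (H k) \<inter> D 0 i (H k') = {}"
        proof (rule equals0I)
          fix x assume "x \<in> D 0 i (H k) \<inter> D 0 i (H k')"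
          then have "int_dist (v k (F x 0 i)) < \<delta>" "int_dist (v k' (F x 0 i)) < \<delta>"
            by (auto simp: D_def H_def)
          then have "k + int m = k' + int m"
            using k(1,2) unfolding v_def \<delta>_def
            by (intro int_dist_shift_unique[OF M]) (auto simp: M_def)
          then show False using k(3) by simp
        qed
      qed
      then have "(\<Sum>k\<in>?J. emeasure \<mu> (D 0 i (H k))) = emeasure \<mu> (\<Union>k\<in>?J. D 0 i (H k))"
        using D_sets[OF i H_open] by (intro sum_emeasure) auto
      also have "\<dots> \<le> 1" by (rule emeasure_le_1)
      finally show "(\<Sum>k\<in>?J. emeasure \<mu> (D 0 i (H k))) \<le> 1" .
    qed
    also have "\<dots> = of_nat n" by simp
    finally show "(\<integral>\<^sup>+ x. of_nat (ord_at V x) \<partial>\<mu>) \<le> of_nat n" .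
  qed
  ultimately show ?thesis using V by blast
qed

lemma dyn_dim_le_of_embedding:
  assumes X: "top_dyn_system X T" and F: "equivariant_embedding X T (cube_shift_space n) shift_map F"
  shows "dyn_dim X T \<le> of_nat n"
  unfolding dyn_dim_def
proof (rule SUP_least)
  fix \<U> assume \<U>: "\<U> \<in> Cov X"
  obtain V where V: "V \<in> Cov X" "refines V \<U>" "ord_dyn X T V \<le> of_nat n"
    using embedded_system_small_order[OF X F \<U>] by blast
  then show "dim_cover X T \<U> \<le> of_nat n"
    unfolding dim_cover_def by (intro INF_lower2[of V]) auto
qed

theorem corollary1p2:
  fixes X :: "'a topology" and T :: "'a \<Rightarrow> 'a"
  assumes "top_dyn_system X T"
  shows "(\<exists>n::nat. n \<ge> 1 \<and> ( \<exists>F. equivariant_embedding X T (cube_shift_space n) shift_map F))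
           \<longleftrightarrow> dyn_dim X T < \<infinity>"
proof
  assume "\<exists>n::nat. n \<ge> 1 \<and> ( \<exists>F. equivariant_embedding X T (cube_shift_space n) shift_map F)"
  then obtain n F where "equivariant_embedding X T (cube_shift_space n) shift_map F" by blast
  then have "dyn_dim X T \<le> of_nat n" by (rule dyn_dim_le_of_embedding[OF assms])
  also have "of_nat n < (\<infinity> :: ennreal)" by (simp add: of_nat_less_top)
  finally show "dyn_dim X T < \<infinity>" .
next
  assume "dyn_dim X T < \<infinity>"
  then obtain D where "dyn_dim X T < of_nat D"
    using ennreal_Ex_less_of_nat[of "dyn_dim X T"] by auto
  from equivariant_embedding_exists[OF assms this refl]
  show "\<exists>n::nat. n \<ge> 1 \<and> ( \<exists>F. equivariant_embedding X T (cube_shift_space n) shift_map F)"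
    by (intro exI[of _ "2 * D + 7"]) simp
qed

end
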